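(* Let $1\le q<p$, let $\bm{X}_q=(X_1,\dots,X_q)$ consist of the first $q$ components of $\bm{X}$, with true cdf $F_q$ and postulated cdf $G_q$, and assume that the density of $G_q$ is $g_q(\bm{x}_q)=\prod_{d=1}^q g_d(x_d|\bm{x}_{<d})$. Consider testing $$H_0: G_q=F_q\quad\text{versus}\quad H_1: G_q\neq F_q.$$ As $n\to\infty$, a valid post-selection bound for the p-value of this test is $$\text{p-value}_{q,adj}=P(\chi^2_{M_q}>D_{obs}),$$ where $M_q=\prod_{d=1}^q(m_d+1)-1$ and $D_{obs}$ is the observed value of the test statistic $$D_q^*=n\sum_{k\in\mathcal{K}_q\cap\mathcal{K}^*}\widehat{\theta}_k^2.$$ That is, under $H_0: G_q=F_q$, for every $t\ge 0$, $$\limsup_{n\to\infty}P\bigl(D_q^*>t\bigr)\le P(\chi^2_{M_q}>t).$$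
   Context: Setting. $\bm{X}=(X_1,\dots,X_p)$ is a random vector with values in $\mathcal{X}\subseteq\mathbb{R}^p$, with true distribution function $F$; $G$ is a hypothesized distribution function. Both are continuous with densities $f$ and $g$ (with respect to Lebesgue measure), and $f(\bm{x})=0$ whenever $g(\bm{x})=0$. The density $g$ factorizes as $g(\bm{x})=\prod_{d=1}^p g_d(x_d|\bm{x}_{<d})$ with $\bm{x}_{<d}=(x_1,\dots,x_{d-1})$, where $g_d(\cdot|\bm{x}_{<d})$ are (conditional) densities with cdfs $G_d(\cdot|\bm{x}_{<d})$ and quantile functions $G_d^{-1}(\cdot|\bm{x}_{<d})$. The Rosenblatt transformation is $\bm{G}_R(\bm{x})=(G_1(x_1),G_2(x_2|x_1),\dots,G_p(x_p|\bm{x}_{<p}))\in[0,1]^p$, with inverse $\bm{G}_R^{-1}(\bm{u})=(x_1,\dots,x_p)$ defined recursively by $x_d=G_d^{-1}(u_d|\bm{x}_{<d})$. It is assumed that the likelihood ratio $d(\bm{u})=f(\bm{G}_R^{-1}(\bm{u}))/g(\bm{G}_R^{-1}(\bm{u}))$ is in $L^2[0,1]^p$. Basis. $T_j$, $j\ge 0$, is the $j$-th normalized shifted Legendre polynomial on $[0,1]$ ($T_0=1$, $T_1(u)=\sqrt{12}(u-0.5)$, and so on; $\{T_j\}_{j\ge0}$ is orthonormal in $L^2[0,1]$), and for a $p$-tuple $k=(j_1,\dots,j_p)$ of nonnegative integers, $T_k(\bm{u})=\prod_{d=1}^p T_{j_d}(u_d)$. Truncation and estimation. Fix (before seeing the data)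 nonnegative integers $m_1,\dots,m_p$, not all zero, and let $\mathcal{K}$ be the set of all $p$-tuples $(j_1,\dots,j_p)\neq(0,\dots,0)$ with $0\le j_d\le m_d$ for all $d$; its cardinality is $M=\prod_{d=1}^p(m_d+1)-1$. Given i.i.d. observations $\bm{x}_1,\dots,\bm{x}_n$ from $\bm{X}$, let $\widehat{\theta}_k=\frac1n\sum_{i=1}^nT_k(\bm{G}_R(\bm{x}_i))$, $k\in\mathcal{K}$. Model selection. Order the estimates by magnitude, $\widehat{\theta}_{(1)}^2\ge\dots\ge\widehat{\theta}_{(M)}^2$; for $k\in\mathcal{K}$, $(k)\in\{1,\dots,M\}$ denotes the rank of $\widehat\theta_k$ in this ordering. Let $K^*\in\{1,\dots,M\}$ be the maximizer of one (chosen in advance) of the criteria $\mathrm{BIC}(K)=\sum_{(k)=1}^K\widehat{\theta}_{(k)}^2-\frac{K\log n}{n}$ or $\mathrm{AIC}(K)=\sum_{(k)=1}^K\widehat{\theta}_{(k)}^2-\frac{2K}{n}$. Index sets. $\mathcal{K}_q=\{k=(j_1,\dots,j_p)\in\mathcal{K}: j_d=0\text{ for all }d=q+1,\dots,p\}$, of cardinality $M_q$, and $\mathcal{K}^*=\{k\in\mathcal{K}:(k)\le K^*\}$, of cardinality $K^*$ (the selected indices). $\chi^2_0$ is the point mass at $0$, and empty sums are $0$. *)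

theory Defs
  imports "HOL-Probability.Probability" "HOL-Computational_Algebra.Polynomial"
begin

(* Vectors in R^p are extensional functions on {..<p}; coordinates are counted from 0, so the
   component called x_d in the mathematical text is x (d - 1) here. *)

abbreviation Leb :: "nat \<Rightarrow> (nat \<Rightarrow> real) measure" where
  "Leb p \<equiv> Pi\<^sub>M {..<p} (\<lambda>_. lborel)"

definition joint_cdf :: "nat \<Rightarrow> (nat \<Rightarrow> real) measure \<Rightarrow> (nat \<Rightarrow> real) \<Rightarrow> real" where
  "joint_cdf q \<mu> y = measure \<mu> {x \<in> space \<mu>. \<forall>d<q. x d \<le> y d}"

definition marginal :: "nat \<Rightarrow> (nat \<Rightarrow> real) measure \<Rightarrow> (nat \<Rightarrow> real) measure" where
  "marginal q \<mu> = distr \<mu> (Leb q) (\<lambda>x. restrict x {..<q})"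

(* A family gd consists of functions gd d y t, to be read as the conditional density of component d
   at t given the vector y of the components before d. *)

definition chain_density :: "(nat \<Rightarrow> (nat \<Rightarrow> real) \<Rightarrow> real \<Rightarrow> real) \<Rightarrow> nat \<Rightarrow> (nat \<Rightarrow> real) \<Rightarrow> real" where
  "chain_density gd q x = (\<Prod>d<q. gd d (restrict x {..<d}) (x d))"

(* Normalization is required only where the density of the conditioning components is positive:
   elsewhere a conditional density is not determined. *)

definition conditional_densities :: "nat \<Rightarrow> (nat \<Rightarrow> (nat \<Rightarrow> real) \<Rightarrow> real \<Rightarrow> real) \<Rightarrow> bool" where
  "conditional_densities p gd \<longleftrightarrow>
     (\<forall>d<p. (\<lambda>(y, t). gd d y t) \<in> borel_measurable (Leb d \<Otimes>\<^sub>M lborel) \<and>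
        (\<forall>y\<in>space (Leb d). \<forall>t. 0 \<le> gd d y t) \<and>
        (\<forall>y\<in>space (Leb d). chain_density gd d y > 0 \<longrightarrow> (\<integral>\<^sup>+ t. ennreal (gd d y t) \<partial>lborel) = 1))"

definition cond_cdf ::
    "(nat \<Rightarrow> (nat \<Rightarrow> real) \<Rightarrow> real \<Rightarrow> real) \<Rightarrow> nat \<Rightarrow> (nat \<Rightarrow> real) \<Rightarrow> real \<Rightarrow> real" where
  "cond_cdf gd d y = cdf (density lborel (\<lambda>t. ennreal (gd d y t)))"

definition quantile :: "(real \<Rightarrow> real) \<Rightarrow> real \<Rightarrow> real" where
  "quantile H u = Inf {t. u \<le> H t}"

definition rosenblatt ::
    "(nat \<Rightarrow> (nat \<Rightarrow> real) \<Rightarrow> real \<Rightarrow> real) \<Rightarrow> nat \<Rightarrow> (nat \<Rightarrow> real) \<Rightarrow> nat \<Rightarrow> real" where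
  "rosenblatt gd p x = (\<lambda>d\<in>{..<p}. cond_cdf gd d (restrict x {..<d}) (x d))"

(* The recursion runs over the dimension: the value at d is the vector of the first d components. *)

primrec rosenblatt_inv ::
    "(nat \<Rightarrow> (nat \<Rightarrow> real) \<Rightarrow> real \<Rightarrow> real) \<Rightarrow> nat \<Rightarrow> (nat \<Rightarrow> real) \<Rightarrow> nat \<Rightarrow> real" where
  "rosenblatt_inv gd 0 u = (\<lambda>_. undefined)"
| "rosenblatt_inv gd (Suc d) u =
     (rosenblatt_inv gd d u)(d := quantile (cond_cdf gd d (rosenblatt_inv gd d u)) (u d))"

definition likelihood_ratio ::
    "(nat \<Rightarrow> (nat \<Rightarrow> real) \<Rightarrow> real \<Rightarrow> real) \<Rightarrow> nat \<Rightarrow> ((nat \<Rightarrow> real) \<Rightarrow> real) \<Rightarrow> ((nat \<Rightarrow> real) \<Rightarrow> real) \<Rightarrow>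
     (nat \<Rightarrow> real) \<Rightarrow> real" where
  "likelihood_ratio gd p f g u = f (rosenblatt_inv gd p u) / g (rosenblatt_inv gd p u)"

(* The completion gives Lebesgue (rather than Borel) measurability, so that the arbitrary values
   of the quantile functions on null sets, e.g. on the boundary of the cube, do not matter. *)

definition L2_cube :: "nat \<Rightarrow> ((nat \<Rightarrow> real) \<Rightarrow> real) \<Rightarrow> bool" where
  "L2_cube p h \<longleftrightarrow>
     (let C = completion (Pi\<^sub>M {..<p} (\<lambda>_. restrict_space lborel {0..1}))
      in h \<in> borel_measurable C \<and> integrable C (\<lambda>u. (h u)\<^sup>2))"

(* Rodrigues' formula: the Legendre polynomial P_j shifted to [0,1] is the j-th derivative of
   (u^2 - u)^j divided by j!, and its squared L^2 norm on [0,1] is 1/(2j+1). *)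

definition legendre :: "nat \<Rightarrow> real \<Rightarrow> real" where
  "legendre j u = sqrt (2 * real j + 1) / fact j * poly ((pderiv ^^ j) ([:0, -1, 1:] ^ j)) u"

lemma legendre_0: "legendre 0 u = 1"
  by (simp add: legendre_def)

lemma legendre_1: "legendre 1 u = sqrt 12 * (u - 1/2)"
proof -
  have "sqrt 12 = sqrt (2\<^sup>2 * 3)" by simp
  also have "\<dots> = 2 * sqrt 3" by (simp only: real_sqrt_mult real_sqrt_abs abs_numeral)
  finally show ?thesis by (simp add: legendre_def pderiv_pCons algebra_simps)
qed

definition tensor_legendre :: "nat \<Rightarrow> (nat \<Rightarrow> nat) \<Rightarrow> (nat \<Rightarrow> real) \<Rightarrow> real" where
  "tensor_legendre p k u = (\<Prod>d<p. legendre (k d) (u d))"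

definition index_set :: "nat \<Rightarrow> (nat \<Rightarrow> nat) \<Rightarrow> (nat \<Rightarrow> nat) set" where
  "index_set p m = {k \<in> (\<Pi>\<^sub>E d\<in>{..<p}. {..m d}). \<exists>d<p. k d \<noteq> 0}"

definition sub_index_set :: "nat \<Rightarrow> (nat \<Rightarrow> nat) \<Rightarrow> nat \<Rightarrow> (nat \<Rightarrow> nat) set" where
  "sub_index_set p m q = {k \<in> index_set p m. \<forall>d. q \<le> d \<and> d < p \<longrightarrow> k d = 0}"

definition theta_hat ::
    "(nat \<Rightarrow> (nat \<Rightarrow> real) \<Rightarrow> real \<Rightarrow> real) \<Rightarrow> nat \<Rightarrow> nat \<Rightarrow> (nat \<Rightarrow> nat \<Rightarrow> real) \<Rightarrow> (nat \<Rightarrow> nat) \<Rightarrow> real" where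
  "theta_hat gd p n xs k = (\<Sum>i<n. tensor_legendre p k (rosenblatt gd p (xs i))) / real n"

(* Ranks 1, 2, ... by decreasing squared value; ties may be broken in any way. *)

definition is_ranking :: "'k set \<Rightarrow> ('k \<Rightarrow> real) \<Rightarrow> ('k \<Rightarrow> nat) \<Rightarrow> bool" where
  "is_ranking K \<theta> rk \<longleftrightarrow>
     bij_betw rk K {1..card K} \<and> (\<forall>k\<in>K. \<forall>l\<in>K. rk k \<le> rk l \<longrightarrow> (\<theta> l)\<^sup>2 \<le> (\<theta> k)\<^sup>2)"

datatype criterion = AIC | BIC

fun penalty :: "criterion \<Rightarrow> nat \<Rightarrow> nat \<Rightarrow> real" where
  "penalty AIC n r = 2 * real r / real n"
| "penalty BIC n r = real r * ln (real n) / real n"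

definition selected :: "'k set \<Rightarrow> ('k \<Rightarrow> nat) \<Rightarrow> nat \<Rightarrow> 'k set" where
  "selected K rk r = {k \<in> K. rk k \<le> r}"

definition criterion_value ::
    "criterion \<Rightarrow> nat \<Rightarrow> 'k set \<Rightarrow> ('k \<Rightarrow> real) \<Rightarrow> ('k \<Rightarrow> nat) \<Rightarrow> nat \<Rightarrow> real" where
  "criterion_value c n K \<theta> rk r = (\<Sum>k\<in>selected K rk r. (\<theta> k)\<^sup>2) - penalty c n r"

definition is_selected_size ::
    "criterion \<Rightarrow> nat \<Rightarrow> 'k set \<Rightarrow> ('k \<Rightarrow> real) \<Rightarrow> ('k \<Rightarrow> nat) \<Rightarrow> nat \<Rightarrow> bool" where
  "is_selected_size c n K \<theta> rk r \<longleftrightarrow>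
     is_arg_max (criterion_value c n K \<theta> rk) (\<lambda>r. r \<in> {1..card K}) r"

definition test_statistic ::
    "nat \<Rightarrow> (nat \<Rightarrow> nat) \<Rightarrow> nat \<Rightarrow> nat \<Rightarrow> ((nat \<Rightarrow> nat) \<Rightarrow> real) \<Rightarrow> ((nat \<Rightarrow> nat) \<Rightarrow> nat) \<Rightarrow> nat \<Rightarrow> real" where
  "test_statistic p m q n \<theta> rk r =
     real n * (\<Sum>k \<in> sub_index_set p m q \<inter> selected (index_set p m) rk r. (\<theta> k)\<^sup>2)"

(* For M = 0 the sum is empty, so this is the point mass at 0. *)

definition chi_squared :: "nat \<Rightarrow> real measure" where
  "chi_squared M =
     distr (Pi\<^sub>M {..<M} (\<lambda>_. density lborel std_normal_density)) borel (\<lambda>z. \<Sum>i<M. (z i)\<^sup>2)"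

definition adjusted_p_value :: "(nat \<Rightarrow> nat) \<Rightarrow> nat \<Rightarrow> real \<Rightarrow> real" where
  "adjusted_p_value m q D_obs = measure (chi_squared ((\<Prod>d<q. m d + 1) - 1)) {D_obs<..}"

end

theory Submission
  imports Defs
begin

text \<open>
  Whatever the selection, the statistic is at most the full sum of squares over all indices that
  involve only the first q components. Under the null hypothesis the Rosenblatt transform of those
  components is uniform on the cube, so orthonormality of the Legendre products makes every linear
  combination of the normalized coefficient estimates a normalized i.i.d. sum, and the
  one-dimensional central limit theorem gives its characteristic function in the limit.

  A multivariate continuity theorem is avoided as follows. For a standard Gaussian vector Z
  independent of V, the expectation of exp(i s Z.V) is both the Laplace transform of the squared
  norm of V at s^2/2 and the Gaussian average of the characteristic function of V at s Z. Hence the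
  Laplace transforms of the squared norms converge by dominated convergence; evaluated at natural
  numbers they are the moments of exp(-|V|^2), which lies in [0,1], and on [0,1] convergence of
  moments implies weak convergence by Weierstrass approximation.
\<close>

section \<open>Orthonormality of the shifted Legendre polynomials\<close>

abbreviation unif01 :: "real measure" where
  "unif01 \<equiv> uniform_measure lborel {0..1}"

lemma prob_space_unif01: "prob_space unif01"
  by (intro prob_space_uniform_measure) auto

lemma unif01_eq_density: "unif01 = density lborel (indicator {0..1})"
  by (simp add: uniform_measure_def divide_ennreal_def)

lemma integral_unif01:
  fixes h :: "real \<Rightarrow> real"
  assumes "h \<in> borel_measurable borel"
  shows "(\<integral>u. h u \<partial>unif01) = (\<integral>u. h u * indicator {0..1} u \<partial>lborel)"
proof -
  have "(\<integral>u. h u \<partial>unif01) = (\<integral>u. h u \<partial>density lborel (\<lambda>u. ennreal (indicator {0..1} u)))"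
    by (simp add: unif01_eq_density ennreal_indicator)
  also have "\<dots> = (\<integral>u. indicator {0..1} u *\<^sub>R h u \<partial>lborel)"
    using assms by (intro integral_density) auto
  finally show ?thesis by (simp add: mult.commute)
qed

lemma poly_measurable [measurable]: "poly (p :: real poly) \<in> borel_measurable borel"
  by (intro borel_measurable_continuous_onI continuous_intros)

lemma AE_unif01: "AE u in unif01. u \<in> {0..1}"
  by (intro AE_uniform_measureI) auto

lemma integrable_unif01_continuous:
  fixes h :: "real \<Rightarrow> real"
  assumes "continuous_on UNIV h"
  shows "integrable unif01 h"
proof -
  interpret prob_space unif01 by (rule prob_space_unif01)
  have "compact (h ` {0..1})"
    using assms by (intro compact_continuous_image) (auto intro: continuous_on_subset)
  then obtain B where B: "\<forall>u\<in>{0..1}. norm (h u) \<le> B"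
    by (meson bounded_iff compact_imp_bounded image_eqI)
  show ?thesis
  proof (rule integrable_const_bound)
    show "AE u in unif01. norm (h u) \<le> B"
      using AE_unif01 by (rule AE_mp) (use B in auto)
    show "h \<in> borel_measurable unif01"
      using borel_measurable_continuous_onI[OF assms] by simp
  qed
qed

lemma integrable_unif01_poly [simp]: "integrable unif01 (poly p)"
  by (intro integrable_unif01_continuous continuous_intros)

section \<open>Calculus of polynomials on the unit interval\<close>

lemma integral_unif01_pderiv: "(\<integral>u. poly (pderiv p) u \<partial>unif01) = poly p 1 - poly p 0"
proof -
  have "(\<integral>u. poly (pderiv p) u * indicator {0..1} u \<partial>lborel) = poly p 1 - poly p 0"
    by (intro integral_FTC_Icc_real) (auto intro: poly_DERIV)
  then show ?thesis by (simp add: integral_unif01)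
qed

lemma integral_unif01_by_parts:
  "(\<integral>u. poly (pderiv p * q) u \<partial>unif01)
    = poly (p * q) 1 - poly (p * q) 0 - (\<integral>u. poly (p * pderiv q) u \<partial>unif01)"
proof -
  have "(\<integral>u. poly (pderiv (p * q)) u \<partial>unif01)
      = (\<integral>u. poly (p * pderiv q) u + poly (pderiv p * q) u \<partial>unif01)"
    by (simp add: pderiv_mult mult.commute)
  also have "\<dots> = (\<integral>u. poly (p * pderiv q) u \<partial>unif01) + (\<integral>u. poly (pderiv p * q) u \<partial>unif01)"
    by (intro Bochner_Integration.integral_add integrable_unif01_poly)
  finally show ?thesis by (simp add: integral_unif01_pderiv)
qed

text \<open>In the product rule for \<open>w ^ Suc n * r\<close> every summand keeps at least
  \<open>n\<close> factors \<open>w\<close>, so one differentiation costs at most one order of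
  vanishing.\<close>

lemma power_dvd_pderiv:
  fixes p w :: "real poly"
  assumes "w ^ Suc n dvd p"
  shows "w ^ n dvd pderiv p"
proof -
  obtain r where "p = w ^ Suc n * r" using assms by (elim dvdE)
  then have "pderiv p = w ^ n * (w * pderiv r + smult (of_nat (Suc n)) (pderiv w * r))"
    by (simp only: pderiv_mult pderiv_power_Suc) (simp add: algebra_simps smult_add_right)
  then show ?thesis by simp
qed

lemma power_dvd_funpow_pderiv:
  fixes w :: "real poly"
  assumes "i \<le> j"
  shows "w ^ (j - i) dvd (pderiv ^^ i) (w ^ j)"
  using assms
proof (induction i)
  case (Suc i)
  then have "w ^ Suc (j - Suc i) dvd (pderiv ^^ i) (w ^ j)"
    by (simp add: Suc_diff_Suc)
  then show ?case using power_dvd_pderiv by simp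
qed simp

text \<open>After fewer than \<open>j\<close> derivatives at least one factor \<open>w\<close>
  survives. For the polynomial u^2 - u this kills the boundary terms at 0 and 1 in the integrations
  by parts below.\<close>

lemma poly_funpow_pderiv_eq_0:
  fixes w :: "real poly"
  assumes "i < j" "poly w x = 0"
  shows "poly ((pderiv ^^ i) (w ^ j)) x = 0"
proof -
  have "w dvd (pderiv ^^ i) (w ^ j)"
    using power_dvd_funpow_pderiv[of i j w] assms
    by (meson dvd_power dvd_trans less_imp_le zero_less_diff)
  then show ?thesis using assms by (metis poly_eq_0_iff_dvd dvd_trans)
qed

text \<open>Each integration by parts moves one derivative from the Rodrigues factor to
  \<open>r\<close>. The induction is on the number \<open>i\<close> of moved derivatives with
  \<open>j\<close> fixed: every boundary term then contains a derivative of order below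
  \<open>j\<close>, which vanishes at both endpoints.\<close>

lemma integral_rodrigues_aux:
  assumes "i \<le> j"
  shows "(\<integral>u. poly ((pderiv ^^ j) ([:0, -1, 1:] ^ j) * r) u \<partial>unif01)
    = (-1) ^ i * (\<integral>u. poly ((pderiv ^^ (j - i)) ([:0, -1, 1:] ^ j) * (pderiv ^^ i) r) u \<partial>unif01)"
  using assms
proof (induction i)
  case (Suc i)
  let ?w = "[:0, -1, 1:] :: real poly"
  have eq: "(pderiv ^^ (j - i)) (?w ^ j) = pderiv ((pderiv ^^ (j - Suc i)) (?w ^ j))"
    using Suc.prems by (metis Suc_diff_Suc Suc_le_lessD comp_apply funpow.simps(2))
  have "poly ((pderiv ^^ (j - Suc i)) (?w ^ j)) x = 0" if "x \<in> {0, 1}" for x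
    using Suc.prems that by (intro poly_funpow_pderiv_eq_0) auto
  then show ?case
    using Suc by (simp only: eq integral_unif01_by_parts) (simp add: Suc)
qed simp

lemma integral_rodrigues:
  "(\<integral>u. poly ((pderiv ^^ j) ([:0, -1, 1:] ^ j) * r) u \<partial>unif01)
    = (-1) ^ j * (\<integral>u. poly ([:0, -1, 1:] ^ j * (pderiv ^^ j) r) u \<partial>unif01)"
  using integral_rodrigues_aux[of j j r] by simp

lemma funpow_pderiv_eq_const:
  assumes "degree (p :: real poly) \<le> n"
  shows "(pderiv ^^ n) p = [:fact n * coeff p n:]"
proof (rule poly_eqI)
  fix i
  show "coeff ((pderiv ^^ n) p) i = coeff [:fact n * coeff p n:] i"
    using assms by (cases i) (simp_all add: coeff_higher_pderiv pochhammer_fact[symmetric] coeff_eq_0)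
qed

text \<open>This is the Beta integral B(a+1, b+1). Integration by parts trades a factor 1 - u for a
  factor u, which is why \<open>a\<close> is generalized. The boundary terms vanish: the
  antiderivative of u^a is 0 at 0, and the power of 1 - u is 0 at 1.\<close>

lemma integral_beta:
  "(\<integral>u. poly ([:0, 1:] ^ a * [:1, -1:] ^ b) u \<partial>unif01) = fact a * fact b / fact (a + b + 1)"
proof (induction b arbitrary: a)
  case 0
  have "pderiv (smult (1 / real (Suc a)) ([:0, 1:] ^ Suc a)) = [:0, 1:] ^ a"
    by (simp add: pderiv_smult pderiv_power_Suc pderiv_pCons del: power_Suc)
  then show ?case
    using integral_unif01_pderiv[of "smult (1 / real (Suc a)) ([:0, 1:] ^ Suc a)"]
    by simp
next
  case (Suc b)
  have 1: "pderiv (smult (1 / real (Suc a)) ([:0, 1:] ^ Suc a)) = [:0, 1:] ^ a"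
    by (simp add: pderiv_smult pderiv_power_Suc pderiv_pCons del: power_Suc)
  have 2: "pderiv ([:1, -1:] ^ Suc b) = smult (- real (Suc b)) ([:1, -1:] ^ b)" 
    by (simp add: pderiv_power_Suc pderiv_pCons del: power_Suc)
  have "(\<integral>u. poly ([:0, 1:] ^ a * [:1, -1:] ^ Suc b) u \<partial>unif01)
     = real (Suc b) / real (Suc a) * (\<integral>u. poly ([:0, 1:] ^ Suc a * [:1, -1:] ^ b) u \<partial>unif01)"
    using integral_unif01_by_parts[of "smult (1 / real (Suc a)) ([:0, 1:] ^ Suc a)" "[:1, -1:] ^ Suc b"]
    unfolding 1 2 by (simp del: of_nat_Suc power_Suc add: mult.left_commute[of _ "real (Suc b)"])
  also have "\<dots> = fact a * fact (Suc b) / fact (a + Suc b + 1)"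
    unfolding Suc by (simp add: divide_simps)
  finally show ?case .
qed

text \<open>Once all \<open>j\<close> derivatives have moved to the factor of index
  \<open>i\<close>, the polynomial (u^2 - u)^i of degree 2i is differentiated \<open>j + i\<close>
  times. As \<open>i \<le> j\<close>, only a constant remains: it is 0 for i < j and (2j)! for i =
  j, where a Beta integral is left and the constants \<open>c\<close> normalize it to 1.\<close>

lemma legendre_orthonormal_le:
  assumes "i \<le> j"
  shows "(\<integral>u. legendre i u * legendre j u \<partial>unif01) = (if i = j then 1 else 0)"
proof -
  let ?w = "[:0, -1, 1:] :: real poly"
  define c where "c i = sqrt (2 * real i + 1) / fact i" for i
  define r where "r i = (pderiv ^^ i) (?w ^ i)" for i
  have deg: "degree (?w ^ n) = 2 * n" for n
    by (simp add: degree_power_eq)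
  have "(\<integral>u. legendre i u * legendre j u \<partial>unif01) = (\<integral>u. (c i * c j) * poly (r j * r i) u \<partial>unif01)"
    by (intro Bochner_Integration.integral_cong) (auto simp: legendre_def c_def r_def)
  also have "\<dots> = c i * c j * (\<integral>u. poly (r j * r i) u \<partial>unif01)"
    by simp
  also have "(\<integral>u. poly (r j * r i) u \<partial>unif01) = (-1) ^ j * (\<integral>u. poly (?w ^ j * (pderiv ^^ j) (r i)) u \<partial>unif01)"
    unfolding r_def by (rule integral_rodrigues)
  also have "(pderiv ^^ j) (r i) = (pderiv ^^ (j + i)) (?w ^ i)"
    by (simp add: r_def funpow_add)
  also have "\<dots> = [:fact (j + i) * coeff (?w ^ i) (j + i):]"
    using assms by (intro funpow_pderiv_eq_const) (simp add: deg)
  finally have *: "(\<integral>u. legendre i u * legendre j u \<partial>unif01) =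
    c i * c j * ((-1) ^ j * (\<integral>u. poly (?w ^ j * [:fact (j + i) * coeff (?w ^ i) (j + i):]) u \<partial>unif01))" .
  show ?thesis
  proof (cases "i = j")
    case False
    then have "coeff (?w ^ i) (j + i) = 0"
      using assms by (intro coeff_eq_0) (simp add: deg)
    then show ?thesis using * False by simp
  next
    case True
    have "coeff (?w ^ j) (j + j) = lead_coeff (?w ^ j)" by (simp only: deg mult_2)
    also have "\<dots> = 1" by (simp add: lead_coeff_power)
    finally have 1: "coeff (?w ^ j) (j + j) = 1" .
    have "(-1) ^ j * (\<integral>u. poly (?w ^ j * [:fact (j + j):]) u \<partial>unif01)
        = fact (j + j) * (\<integral>u. poly ([:0, 1:] ^ j * [:1, -1:] ^ j) u \<partial>unif01)"
    proof -
      \<comment> \<open>The factorization u^2 - u = -u(1 - u) exposes the Beta integrand; its sign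
        (-1)^j cancels the one produced by the \<open>j\<close> integrations by parts.\<close>
      have "?w = [:0, 1:] * - [:1, -1:]" by simp
      then have "?w ^ j = smult ((-1) ^ j) ([:0, 1:] ^ j * [:1, -1:] ^ j)"
        by (simp only: power_mult_distrib power_minus[of "[:1, -1:]"]) (simp add: minus_one_power_iff)
      then show ?thesis by simp
    qed
    with * have "(\<integral>u. legendre i u * legendre j u \<partial>unif01)
        = c j * c j * (fact (j + j) * (fact j * fact j / fact (j + j + 1)))"
      by (simp only: True 1 mult_1_right integral_beta)
    also have "c j * c j = (2 * real j + 1) / (fact j * fact j)"
      by (simp add: c_def)
    also have "\<dots> * (fact (j + j) * (fact j * fact j / fact (j + j + 1))) = 1"
    proof -
      have "fact (j + j + 1) = (2 * real j + 1) * fact (j + j)" by simp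
      moreover have "2 * real j + 1 \<noteq> 0" by linarith
      ultimately show ?thesis by (simp only:) simp
    qed
    finally show ?thesis using True by simp
  qed
qed

lemma legendre_orthonormal:
  "(\<integral>u. legendre i u * legendre j u \<partial>unif01) = (if i = j then 1 else 0)"
  using legendre_orthonormal_le[of i j] legendre_orthonormal_le[of j i]
  by (cases "i \<le> j") (auto simp: mult.commute)

section \<open>From characteristic functions to chi-squared tails\<close>

lemma moments_imp_integral_tendsto:
  fixes W :: "nat \<Rightarrow> 'a \<Rightarrow> real" and V :: "'b \<Rightarrow> real" and f :: "real \<Rightarrow> real"
  assumes M: "prob_space M" and N: "prob_space N"
    and W: "\<And>n. W n \<in> borel_measurable M" "\<And>n x. x \<in> space M \<Longrightarrow> W n x \<in> {0..1}"
    and V: "V \<in> borel_measurable N" "\<And>x. x \<in> space N \<Longrightarrow> V x \<in> {0..1}"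
    and moments: "\<And>k. (\<lambda>n. \<integral>x. W n x ^ k \<partial>M) \<longlonglongrightarrow> (\<integral>x. V x ^ k \<partial>N)"
    and f: "continuous_on UNIV f" "\<And>x. \<bar>f x\<bar> \<le> 1"
  shows "(\<lambda>n. \<integral>x. f (W n x) \<partial>M) \<longlonglongrightarrow> (\<integral>x. f (V x) \<partial>N)"
proof (rule tendstoI)
  fix e :: real assume "0 < e"
  interpret M: prob_space M by fact
  interpret N: prob_space N by fact
  note [measurable] = W(1) V(1) borel_measurable_continuous_onI[OF f(1)]
  \<comment> \<open>The error budget has three parts of size e/3: replacing \<open>f\<close> by the
    polynomial \<open>g\<close> along \<open>W n\<close>, uniformly in \<open>n\<close>; the
    convergence for \<open>g\<close>, which follows from the moments by linearity; and replacing
    \<open>f\<close> by \<open>g\<close> along \<open>V\<close>.\<close>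
  obtain g where "real_polynomial_function g" and g: "\<And>x. x \<in> {0..1} \<Longrightarrow> \<bar>f x - g x\<bar> < e / 3"
    using Stone_Weierstrass_real_polynomial_function[of "{0..1::real}" f "e / 3"] \<open>0 < e\<close> f(1)
    by (auto intro: continuous_on_subset)
  then obtain a d where a: "g = (\<lambda>x. \<Sum>i\<le>d. a i * x ^ i)"
    using real_polynomial_function_iff_sum by blast
  have iW: "integrable M (\<lambda>x. W n x ^ i)" for n i
    using W(2) by (intro M.integrable_const_bound[of _ 1] AE_I2) (auto simp: power_le_one power_abs)
  have iV: "integrable N (\<lambda>x. V x ^ i)" for i
    using V(2) by (intro N.integrable_const_bound[of _ 1] AE_I2) (auto simp: power_le_one power_abs)
  have ifW: "integrable M (\<lambda>x. f (W n x))" for n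
    using f(2) by (intro M.integrable_const_bound[of _ 1] AE_I2) auto
  have ifV: "integrable N (\<lambda>x. f (V x))"
    using f(2) by (intro N.integrable_const_bound[of _ 1] AE_I2) auto
  have igW: "integrable M (\<lambda>x. g (W n x))" for n unfolding a using iW by simp
  have igV: "integrable N (\<lambda>x. g (V x))" unfolding a using iV by simp
  have "(\<lambda>n. \<Sum>i\<le>d. a i * (\<integral>x. W n x ^ i \<partial>M)) \<longlonglongrightarrow> (\<Sum>i\<le>d. a i * (\<integral>x. V x ^ i \<partial>N))"
    by (intro tendsto_intros moments)
  then have "(\<lambda>n. \<integral>x. g (W n x) \<partial>M) \<longlonglongrightarrow> (\<integral>x. g (V x) \<partial>N)"
    unfolding a using iW iV by simp
  then have ev: "\<forall>\<^sub>F n in sequentially. dist (\<integral>x. g (W n x) \<partial>M) (\<integral>x. g (V x) \<partial>N) < e / 3"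
    using \<open>0 < e\<close> by (intro tendstoD) auto
  have fW: "\<bar>(\<integral>x. f (W n x) \<partial>M) - (\<integral>x. g (W n x) \<partial>M)\<bar> \<le> e / 3" for n
  proof -
    have "\<bar>\<integral>x. f (W n x) - g (W n x) \<partial>M\<bar> \<le> (\<integral>x. \<bar>f (W n x) - g (W n x)\<bar> \<partial>M)"
      by (rule integral_abs_bound)
    also have "\<dots> \<le> (\<integral>x. e / 3 \<partial>M)"
      using W(2) g ifW igW by (intro integral_mono) (auto intro: less_imp_le)
    finally show ?thesis using ifW igW by (simp add: M.prob_space)
  qed
  have fV: "\<bar>(\<integral>x. f (V x) \<partial>N) - (\<integral>x. g (V x) \<partial>N)\<bar> \<le> e / 3"
  proof -
    have "\<bar>\<integral>x. f (V x) - g (V x) \<partial>N\<bar> \<le> (\<integral>x. \<bar>f (V x) - g (V x)\<bar> \<partial>N)"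
      by (rule integral_abs_bound)
    also have "\<dots> \<le> (\<integral>x. e / 3 \<partial>N)"
      using V(2) g ifV igV by (intro integral_mono) (auto intro: less_imp_le)
    finally show ?thesis using ifV igV by (simp add: N.prob_space)
  qed
  show "\<forall>\<^sub>F n in sequentially. dist (\<integral>x. f (W n x) \<partial>M) (\<integral>x. f (V x) \<partial>N) < e"
  proof (rule eventually_mono[OF ev])
    fix n assume "dist (\<integral>x. g (W n x) \<partial>M) (\<integral>x. g (V x) \<partial>N) < e / 3"
    then show "dist (\<integral>x. f (W n x) \<partial>M) (\<integral>x. f (V x) \<partial>N) < e"
      using fW[of n] fV unfolding dist_real_def by linarith
  qed
qed

text \<open>The last hypothesis excludes an atom of \<open>V\<close> at \<open>c\<close>. This makes
  \<open>c\<close> a continuity point of the limiting cdf, where weak convergence gives convergence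
  of the cdfs.\<close>

lemma moments_imp_tail_tendsto:
  fixes W :: "nat \<Rightarrow> 'a \<Rightarrow> real" and V :: "'b \<Rightarrow> real"
  assumes M: "prob_space M" and N: "prob_space N"
    and W: "\<And>n. W n \<in> borel_measurable M" "\<And>n x. x \<in> space M \<Longrightarrow> W n x \<in> {0..1}"
    and V: "V \<in> borel_measurable N" "\<And>x. x \<in> space N \<Longrightarrow> V x \<in> {0..1}"
    and moments: "\<And>k. (\<lambda>n. \<integral>x. W n x ^ k \<partial>M) \<longlonglongrightarrow> (\<integral>x. V x ^ k \<partial>N)"
    and c: "measure N {x \<in> space N. V x = c} = 0"
  shows "(\<lambda>n. measure M {x \<in> space M. W n x \<le> c}) \<longlonglongrightarrow> measure N {x \<in> space N. V x \<le> c}"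
proof -
  interpret M: prob_space M by fact
  interpret N: prob_space N by fact
  note [measurable] = W(1) V(1)
  have rW: "real_distribution (distr M borel (W n))" for n
    by (rule M.real_distribution_distr) simp
  have rV: "real_distribution (distr N borel V)"
    by (rule N.real_distribution_distr) simp
  interpret V: real_distribution "distr N borel V" by fact
  have "weak_conv_m (\<lambda>n. distr M borel (W n)) (distr N borel V)"
  proof (rule integral_bdd_continuous_conv_imp_weak_conv[OF rW rV])
    fix f :: "real \<Rightarrow> real" assume f: "\<And>x. isCont f x" "\<And>x. \<bar>f x\<bar> \<le> 1"
    then have cont: "continuous_on UNIV f" by (simp add: continuous_at_imp_continuous_on)
    then have [measurable]: "f \<in> borel_measurable borel"
      by (rule borel_measurable_continuous_onI)
    have "(\<lambda>n. \<integral>x. f (W n x) \<partial>M) \<longlonglongrightarrow> (\<integral>x. f (V x) \<partial>N)"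
      by (rule moments_imp_integral_tendsto[OF M N W V moments cont f(2)])
    then show "(\<lambda>n. integral\<^sup>L (distr M borel (W n)) f) \<longlonglongrightarrow> integral\<^sup>L (distr N borel V) f"
      by (simp add: integral_distr)
  qed
  moreover have "isCont (cdf (distr N borel V)) c"
  proof -
    have "V -` {c} \<inter> space N = {x \<in> space N. V x = c}" by auto
    then show ?thesis using c by (simp add: V.isCont_cdf measure_distr)
  qed
  ultimately have "(\<lambda>n. cdf (distr M borel (W n)) c) \<longlonglongrightarrow> cdf (distr N borel V) c"
    by (simp add: weak_conv_m_def weak_conv_def)
  moreover have "W n -` {..c} \<inter> space M = {x \<in> space M. W n x \<le> c}" for n by auto
  moreover have "V -` {..c} \<inter> space N = {x \<in> space N. V x \<le> c}" by auto
  ultimately show ?thesis by (simp add: cdf_def measure_distr)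
qed

section \<open>Gaussian averaging and Laplace transforms of squared norms\<close>

abbreviation std_gaussian :: "nat \<Rightarrow> (nat \<Rightarrow> real) measure" where
  "std_gaussian m \<equiv> Pi\<^sub>M {..<m} (\<lambda>_. std_normal_distribution)"

lemma prob_space_std_normal: "prob_space std_normal_distribution"
  by (rule real_distribution.axioms(1)) (rule real_dist_normal_dist)

lemma prob_space_std_gaussian: "prob_space (std_gaussian m)"
  by (intro prob_space_PiM prob_space_std_normal)

lemma char_std_gaussian:
  fixes x :: "nat \<Rightarrow> real"
  shows "(\<integral>z. iexp (\<Sum>j<m. z j * x j) \<partial>std_gaussian m) = complex_of_real (exp (- (\<Sum>j<m. (x j)\<^sup>2) / 2))"
proof -
  interpret N: prob_space std_normal_distribution by (rule prob_space_std_normal)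
  interpret product_prob_space "\<lambda>_::nat. std_normal_distribution" ..
  have "(\<integral>z. iexp (\<Sum>j<m. z j * x j) \<partial>std_gaussian m) = (\<integral>z. (\<Prod>j<m. iexp (x j * z j)) \<partial>std_gaussian m)"
    by (simp add: exp_sum sum_distrib_left mult_ac)
  also have "\<dots> = (\<Prod>j<m. \<integral>u. iexp (x j * u) \<partial>std_normal_distribution)"
    by (intro product_integral_prod N.integrable_const_bound[of _ 1] AE_I2) auto
  also have "\<dots> = (\<Prod>j<m. complex_of_real (exp (- ((x j)\<^sup>2) / 2)))"
    using char_std_normal_distribution by (simp add: char_def fun_eq_iff)
  also have "\<dots> = complex_of_real (exp (- (\<Sum>j<m. (x j)\<^sup>2) / 2))"
    by (simp flip: of_real_prod add: exp_sum[symmetric] sum_divide_distrib sum_negf)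
  finally show ?thesis .
qed

text \<open>Fubini for exp(i z.V). Integrating over the Gaussian \<open>z\<close> first gives, by
  \<open>char_std_gaussian\<close>, the function of the squared norm; integrating over
  \<open>\<omega>\<close> first leaves the characteristic function of the vector at the frequency
  \<open>z\<close>.\<close>

lemma integral_exp_square_norm:
  fixes V :: "nat \<Rightarrow> 'a \<Rightarrow> real"
  assumes "prob_space M" and [measurable]: "\<And>j. j < m \<Longrightarrow> V j \<in> borel_measurable M"
  shows "complex_of_real (\<integral>\<omega>. exp (- (\<Sum>j<m. (V j \<omega>)\<^sup>2) / 2) \<partial>M)
    = (\<integral>z. \<integral>\<omega>. iexp (\<Sum>j<m. z j * V j \<omega>) \<partial>M \<partial>std_gaussian m)"
proof -
  interpret M: prob_space M by fact
  interpret G: prob_space "std_gaussian m" by (rule prob_space_std_gaussian)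
  interpret pair_prob_space M "std_gaussian m" ..
  have [measurable]: "(\<lambda>z. z j) \<in> borel_measurable (std_gaussian m)" if "j < m" for j
    using that measurable_component_singleton[of j "{..<m}" "\<lambda>_. std_normal_distribution"] by simp
  have "(\<lambda>p. \<Sum>j<m. snd p j * V j (fst p)) \<in> borel_measurable (M \<Otimes>\<^sub>M std_gaussian m)"
    by (intro borel_measurable_sum borel_measurable_times measurable_compose[OF measurable_fst] measurable_compose[OF measurable_snd]) simp_all
  then have "integrable (M \<Otimes>\<^sub>M std_gaussian m) (\<lambda>(\<omega>, z). iexp (\<Sum>j<m. z j * V j \<omega>))"
    by (intro P.integrable_const_bound[of _ 1]) (auto simp: split_beta)
  from Fubini_integral[OF this] show ?thesis
    unfolding char_std_gaussian integral_complex_of_real by (rule sym)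
qed

lemma char_imp_laplace_tendsto:
  fixes V :: "nat \<Rightarrow> nat \<Rightarrow> 'a \<Rightarrow> real"
  assumes M: "prob_space M" and V: "\<And>n j. j < m \<Longrightarrow> V n j \<in> borel_measurable M"
    and char: "\<And>a. (\<lambda>n. \<integral>\<omega>. iexp (\<Sum>j<m. a j * V n j \<omega>) \<partial>M)
      \<longlonglongrightarrow> complex_of_real (exp (- (\<Sum>j<m. (a j)\<^sup>2) / 2))"
    and "0 \<le> l"
  shows "(\<lambda>n. \<integral>\<omega>. exp (- l * (\<Sum>j<m. (V n j \<omega>)\<^sup>2)) \<partial>M)
    \<longlonglongrightarrow> (\<integral>z. exp (- l * (\<Sum>j<m. (z j)\<^sup>2)) \<partial>std_gaussian m)"
proof -
  interpret M: prob_space M by fact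
  interpret G: prob_space "std_gaussian m" by (rule prob_space_std_gaussian)
  have z [measurable]: "(\<lambda>z. z j) \<in> borel_measurable (std_gaussian m)" if "j < m" for j
    using that measurable_component_singleton[of j "{..<m}" "\<lambda>_. std_normal_distribution"] by simp
  \<comment> \<open>With this scaling (s x)^2 / 2 = l x^2, so
    \<open>integral_exp_square_norm\<close> applied to the scaled vector yields the Laplace
    transform at \<open>l\<close>.\<close>
  define s where "s = sqrt (2 * l)"
  have s: "s\<^sup>2 = 2 * l" using \<open>0 \<le> l\<close> by (simp add: s_def)
  have eq: "exp (- l * (\<Sum>j<m. (x j)\<^sup>2)) = exp (- (\<Sum>j<m. (s * x j)\<^sup>2) / 2)" for x :: "nat \<Rightarrow> real"
    by (simp add: power_mult_distrib s flip: sum_distrib_left)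
  have "(\<lambda>n. \<integral>z. \<integral>\<omega>. iexp (\<Sum>j<m. z j * (s * V n j \<omega>)) \<partial>M \<partial>std_gaussian m)
      \<longlonglongrightarrow> (\<integral>z. complex_of_real (exp (- (\<Sum>j<m. (s * z j)\<^sup>2) / 2)) \<partial>std_gaussian m)"
  \<comment> \<open>For each fixed \<open>z\<close> the limit is the hypothesis \<open>char\<close>
    with coefficients \<open>s * z j\<close>. The constant 1 dominates because a characteristic
    function has modulus at most 1.\<close>
  proof (rule integral_dominated_convergence[where w="\<lambda>_. 1"])
    show "AE z in std_gaussian m. (\<lambda>n. \<integral>\<omega>. iexp (\<Sum>j<m. z j * (s * V n j \<omega>)) \<partial>M)
        \<longlonglongrightarrow> complex_of_real (exp (- (\<Sum>j<m. (s * z j)\<^sup>2) / 2))"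
      using char[of "\<lambda>j. s * z j" for z] by (intro AE_I2) (simp add: mult_ac)
    have "(\<lambda>p. \<Sum>j<m. fst p j * (s * V n j (snd p))) \<in> borel_measurable (std_gaussian m \<Otimes>\<^sub>M M)" for n
      using V by (intro borel_measurable_sum borel_measurable_times borel_measurable_const
        measurable_compose[OF measurable_fst] measurable_compose[OF measurable_snd] z) auto
    moreover have "(\<lambda>x. iexp x) \<in> borel_measurable borel" by simp
    ultimately have "(\<lambda>p. iexp (\<Sum>j<m. fst p j * (s * V n j (snd p)))) \<in> borel_measurable (std_gaussian m \<Otimes>\<^sub>M M)" for n
      by (rule measurable_compose)
    then show "(\<lambda>z. \<integral>\<omega>. iexp (\<Sum>j<m. z j * (s * V n j \<omega>)) \<partial>M) \<in> borel_measurable (std_gaussian m)" for n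
      by (intro M.borel_measurable_lebesgue_integral) (simp add: split_beta)
    show "AE z in std_gaussian m. norm (\<integral>\<omega>. iexp (\<Sum>j<m. z j * (s * V n j \<omega>)) \<partial>M) \<le> 1" for n
    proof (rule AE_I2)
      fix z
      have "norm (\<integral>\<omega>. iexp (\<Sum>j<m. z j * (s * V n j \<omega>)) \<partial>M) \<le> (\<integral>\<omega>. norm (iexp (\<Sum>j<m. z j * (s * V n j \<omega>))) \<partial>M)"
        by (rule integral_norm_bound)
      then show "norm (\<integral>\<omega>. iexp (\<Sum>j<m. z j * (s * V n j \<omega>)) \<partial>M) \<le> 1"
        by (simp add: M.prob_space)
    qed
  qed auto
  moreover have "(\<integral>z. \<integral>\<omega>. iexp (\<Sum>j<m. z j * (s * V n j \<omega>)) \<partial>M \<partial>std_gaussian m)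
      = complex_of_real (\<integral>\<omega>. exp (- (\<Sum>j<m. (s * V n j \<omega>)\<^sup>2) / 2) \<partial>M)" for n
    using V by (intro integral_exp_square_norm[symmetric] M borel_measurable_times) auto
  ultimately show ?thesis
    unfolding eq by (simp only: integral_complex_of_real tendsto_of_real_iff)
qed

text \<open>The last coordinate is integrated first: with the others fixed, the sum hits
  \<open>t\<close> for at most two of its values, a null set of the normal law. For
  \<open>m = 0\<close> the sum is constantly 0, so at least one coordinate is required.\<close>

lemma AE_std_gaussian_sum_squares_neq:
  assumes "m \<noteq> 0"
  shows "AE z in std_gaussian m. (\<Sum>j<m. (z j)\<^sup>2) \<noteq> t"
proof -
  obtain k where m: "m = Suc k" using assms by (cases m) auto
  interpret N: prob_space std_normal_distribution by (rule prob_space_std_normal)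
  interpret product_prob_space "\<lambda>_::nat. std_normal_distribution" ..
  have ins: "{..<Suc k} = insert k {..<k}" by auto
  have z [measurable]: "(\<lambda>z. z j) \<in> borel_measurable (std_gaussian (Suc k))" if "j < Suc k" for j
    using that measurable_component_singleton[of j "{..<Suc k}" "\<lambda>_. std_normal_distribution"] by simp
  define I :: "(nat \<Rightarrow> real) \<Rightarrow> ennreal" where "I z = indicator {z. (\<Sum>j<Suc k. (z j)\<^sup>2) = t} z" for z
  have S: "(\<lambda>z. \<Sum>j<Suc k. (z j)\<^sup>2) \<in> borel_measurable (std_gaussian (Suc k))"
    by (intro borel_measurable_sum borel_measurable_power z) auto
  have I [measurable]: "I \<in> borel_measurable (std_gaussian (Suc k))"
    unfolding I_def indicator_def using S by (simp add: measurable_If)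
  have "(\<integral>\<^sup>+ z. I z \<partial>std_gaussian (Suc k))
      = (\<integral>\<^sup>+ z. \<integral>\<^sup>+ u. I (z(k := u)) \<partial>std_normal_distribution \<partial>std_gaussian k)"
    using I unfolding ins by (intro product_nn_integral_insert) auto
  also have "\<dots> = (\<integral>\<^sup>+ z. 0 \<partial>std_gaussian k)"
  proof (rule nn_integral_cong)
    fix z
    define r where "r = t - (\<Sum>j<k. (z j)\<^sup>2)"
    have "finite {u::real. u\<^sup>2 = r}"
    proof (rule finite_subset)
      show "{u::real. u\<^sup>2 = r} \<subseteq> {sqrt r, - sqrt r}" by auto
    qed simp
    then have "AE u in lborel. u \<notin> {u::real. u\<^sup>2 = r}"
      by (intro AE_not_in finite_imp_null_set_lborel)
    then have "AE u in std_normal_distribution. u\<^sup>2 \<noteq> r"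
      by (subst AE_density) auto
    then have "AE u in std_normal_distribution. I (z(k := u)) = 0"
      by (rule AE_mp) (auto simp: I_def r_def indicator_def)
    then have "(\<integral>\<^sup>+ u. I (z(k := u)) \<partial>std_normal_distribution) = (\<integral>\<^sup>+ u. 0 \<partial>std_normal_distribution)"
      by (rule nn_integral_cong_AE)
    then show "(\<integral>\<^sup>+ u. I (z(k := u)) \<partial>std_normal_distribution) = 0" by simp
  qed
  finally have "(\<integral>\<^sup>+ z. I z \<partial>std_gaussian (Suc k)) = 0" by simp
  then have "AE z in std_gaussian (Suc k). I z = 0"
    using nn_integral_0_iff_AE[OF I] by simp
  then show ?thesis unfolding m
    by (rule AE_mp) (auto simp: I_def)
qed

text \<open>The map y -> exp(-y) sends squared norms into [0,1] and reverses the order, so an upper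
  tail becomes a lower tail of exp(-Y), whose k-th moment is the Laplace transform at k. The limit
  law has no atom at \<open>t\<close>; hence the nonstrict tail on the left can be paired with the
  strict one on the right.\<close>

lemma char_imp_chi_squared_tail:
  fixes V :: "nat \<Rightarrow> nat \<Rightarrow> 'a \<Rightarrow> real"
  assumes M: "prob_space M" and V: "\<And>n j. j < m \<Longrightarrow> V n j \<in> borel_measurable M"
    and char: "\<And>a. (\<lambda>n. \<integral>\<omega>. iexp (\<Sum>j<m. a j * V n j \<omega>) \<partial>M)
      \<longlonglongrightarrow> complex_of_real (exp (- (\<Sum>j<m. (a j)\<^sup>2) / 2))"
    and "m \<noteq> 0"
  shows "(\<lambda>n. measure M {\<omega> \<in> space M. t \<le> (\<Sum>j<m. (V n j \<omega>)\<^sup>2)}) \<longlonglongrightarrow> measure (chi_squared m) {t<..}"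
proof -
  interpret M: prob_space M by fact
  interpret G: prob_space "std_gaussian m" by (rule prob_space_std_gaussian)
  have z: "(\<lambda>z. z j) \<in> borel_measurable (std_gaussian m)" if "j < m" for j
    using that measurable_component_singleton[of j "{..<m}" "\<lambda>_. std_normal_distribution"] by simp
  define Y where "Y n \<omega> = (\<Sum>j<m. (V n j \<omega>)\<^sup>2)" for n \<omega>
  define Z :: "(nat \<Rightarrow> real) \<Rightarrow> real" where "Z z = (\<Sum>j<m. (z j)\<^sup>2)" for z
  have [measurable]: "Y n \<in> borel_measurable M" for n
    unfolding Y_def using V by (intro borel_measurable_sum borel_measurable_power) auto
  have [measurable]: "Z \<in> borel_measurable (std_gaussian m)"
    unfolding Z_def by (intro borel_measurable_sum borel_measurable_power z) auto
  have nn: "0 \<le> Y n \<omega>" "0 \<le> Z z" for n \<omega> z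
    by (auto simp: Y_def Z_def intro: sum_nonneg)
  have neq: "AE z in std_gaussian m. Z z \<noteq> t"
    unfolding Z_def using \<open>m \<noteq> 0\<close> by (rule AE_std_gaussian_sum_squares_neq)
  have "(\<lambda>n. measure M {\<omega> \<in> space M. exp (- Y n \<omega>) \<le> exp (- t)})
      \<longlonglongrightarrow> measure (std_gaussian m) {z \<in> space (std_gaussian m). exp (- Z z) \<le> exp (- t)}"
  proof (rule moments_imp_tail_tendsto[OF M prob_space_std_gaussian])
    fix k :: nat
    have "exp (- y) ^ k = exp (- real k * y)" for y :: real
      by (simp flip: exp_of_nat_mult)
    then show "(\<lambda>n. \<integral>\<omega>. exp (- Y n \<omega>) ^ k \<partial>M) \<longlonglongrightarrow> (\<integral>z. exp (- Z z) ^ k \<partial>std_gaussian m)"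
      using char_imp_laplace_tendsto[OF M V char, of "real k"] by (simp add: Y_def Z_def)
    have "{z \<in> space (std_gaussian m). Z z = t} \<in> null_sets (std_gaussian m)"
      using neq by (subst (asm) AE_iff_null) auto
    then show "measure (std_gaussian m) {z \<in> space (std_gaussian m). exp (- Z z) = exp (- t)} = 0"
      by (simp add: null_sets_def measure_def)
  qed (use nn in auto)
  moreover have "measure (chi_squared m) {t<..} = measure (std_gaussian m) {z \<in> space (std_gaussian m). t \<le> Z z}"
  proof -
    have "measure (chi_squared m) {t<..} = measure (std_gaussian m) (Z -` {t<..} \<inter> space (std_gaussian m))"
      unfolding chi_squared_def Z_def[symmetric] by (intro measure_distr) auto
    also have "\<dots> = measure (std_gaussian m) {z \<in> space (std_gaussian m). t \<le> Z z}"
    proof (rule G.finite_measure_eq_AE)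
      show "AE z in std_gaussian m. (z \<in> Z -` {t<..} \<inter> space (std_gaussian m))
          = (z \<in> {z \<in> space (std_gaussian m). t \<le> Z z})"
        using neq by (rule AE_mp) auto
    qed auto
    finally show ?thesis .
  qed
  ultimately show ?thesis by (simp add: Y_def)
qed

section \<open>The Rosenblatt transformation\<close>

text \<open>The cdf is continuous but may have flat pieces, so no inverse is used. The sublevel set
  is a closed half-line \<open>{..Sup S}\<close>, and the intermediate value theorem shows that the
  level \<open>u\<close> is attained at its endpoint.\<close>

lemma measure_le_cdf_eq:
  assumes "real_distribution M" "\<And>x. measure M {x} = 0" "0 < u" "u < 1"
  shows "measure M {x. cdf M x \<le> u} = u"
proof -
  interpret real_distribution M by fact
  have cont: "continuous_on UNIV (cdf M)"
    using assms(2) by (intro continuous_at_imp_continuous_on) (simp add: isCont_cdf)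
  obtain a where a: "cdf M a < u"
    using order_tendstoD(2)[OF cdf_lim_at_bot assms(3)] by (auto simp: eventually_at_bot_linorder)
  obtain b where b: "cdf M b > u"
    using order_tendstoD(1)[OF cdf_lim_at_top_prob assms(4)] by (auto simp: eventually_at_top_linorder)
  define S where "S = {x. cdf M x \<le> u}"
  have "closed S" unfolding S_def
    using closed_Collect_le[OF cont continuous_on_const] by simp
  moreover have "a \<in> S" "bdd_above S" unfolding S_def
    using a b cdf_nondecreasing by (auto intro!: bdd_aboveI[of _ b]) (meson le_cases not_le order_trans)
  ultimately have s: "Sup S \<in> S" using closed_contains_Sup by blast
  have S: "S = {..Sup S}"
    using \<open>bdd_above S\<close> s cdf_nondecreasing unfolding S_def
    by (auto intro: cSup_upper order_trans)
  have "Sup S < b" using s b cdf_nondecreasing unfolding S_def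
    by (metis (no_types, lifting) mem_Collect_eq not_le order_trans)
  moreover have "isCont (cdf M) x" for x using assms(2) by (simp add: isCont_cdf)
  ultimately obtain x where x: "Sup S \<le> x" "cdf M x = u"
    using IVT[of "cdf M" "Sup S" u b] s b unfolding S_def by auto
  \<comment> \<open>The point \<open>x\<close> attains the level, so it belongs to \<open>S\<close>
    and cannot lie beyond \<open>Sup S\<close>; it is therefore the endpoint itself.\<close>
  then have "x \<in> S" by (simp add: S_def)
  then have "x \<le> Sup S" using \<open>bdd_above S\<close> cSup_upper by blast
  with x have "cdf M (Sup S) = u" by simp
  then show ?thesis using S by (simp add: S_def cdf_def)
qed

lemma distr_cdf_unif01:
  assumes "real_distribution M" "\<And>x. measure M {x} = 0"
  shows "distr M borel (cdf M) = unif01"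
proof (rule cdf_unique)
  interpret real_distribution M by fact
  have mon: "mono (cdf M)" by (simp add: mono_def cdf_nondecreasing)
  have [measurable]: "cdf M \<in> borel_measurable borel"
    using mon by (rule borel_measurable_mono)
  show "real_distribution (distr M borel (cdf M))"
    by (rule real_distribution_distr) simp
  show "real_distribution unif01"
    using prob_space_unif01 by (simp add: real_distribution_def real_distribution_axioms_def)
  have le1: "cdf M x \<le> 1" for x by (rule cdf_bounded_prob)
  have ge0: "0 \<le> cdf M x" for x by (rule cdf_nonneg)
  show "cdf (distr M borel (cdf M)) = cdf unif01"
  proof
    fix u :: real
    have 1: "cdf (distr M borel (cdf M)) u = measure M {x. cdf M x \<le> u}"
      unfolding cdf_def[of "distr M borel (cdf M)"] by (simp add: measure_distr vimage_def)
    consider "u < 0" | "u = 0" | "0 < u" "u < 1" | "1 \<le> u" by linarith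
    then have "measure M {x. cdf M x \<le> u} = min 1 (max 0 u)"
    proof cases
      case 1
      then have "{x. cdf M x \<le> u} = {}" using ge0 by (auto simp: not_le intro: less_le_trans)
      then show ?thesis using 1 by simp
    next
      case 2
      \<comment> \<open>Level 0 is squeezed by small positive levels. The cap 1/2 keeps the level
        strictly below 1 even for large \<open>e\<close>.\<close>
      have "measure M {x. cdf M x \<le> 0} \<le> e" if "0 < e" for e
      proof -
        have "measure M {x. cdf M x \<le> 0} \<le> measure M {x. cdf M x \<le> min e (1/2)}"
          using that by (intro finite_measure_mono) auto
        also have "\<dots> = min e (1/2)"
          using that by (intro measure_le_cdf_eq assms) auto
        finally show ?thesis by simp
      qed
      then have "measure M {x. cdf M x \<le> 0} \<le> 0" by (rule field_le_epsilon[of _ 0, simplified])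
      then show ?thesis using 2 by (simp add: measure_le_0_iff)
    next
      case 3
      then show ?thesis using measure_le_cdf_eq[OF assms] by simp
    next
      case 4
      then have "{x. cdf M x \<le> u} = UNIV" using le1 by (auto intro: order_trans)
      then show ?thesis using 4 prob_space by simp
    qed
    moreover have "cdf unif01 u = min 1 (max 0 u)"
    proof -
      have "{0..1} \<inter> {..u} = (if u < 0 then {} else {0..min 1 u})" by auto
      then show ?thesis by (simp add: cdf_def)
    qed
    ultimately show "cdf (distr M borel (cdf M)) u = cdf unif01 u" using 1 by simp
  qed
qed

lemma distr_cdf_density:
  fixes h :: "real \<Rightarrow> real"
  assumes [measurable]: "h \<in> borel_measurable borel" and "\<And>t. 0 \<le> h t"
    and "(\<integral>\<^sup>+ t. ennreal (h t) \<partial>lborel) = 1"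
  defines "M \<equiv> density lborel (\<lambda>t. ennreal (h t))"
  shows "distr M borel (cdf M) = unif01"
proof (rule distr_cdf_unif01)
  have "prob_space M"
    by (rule prob_spaceI) (simp add: M_def emeasure_density assms)
  then show "real_distribution M"
    by (simp add: real_distribution_def real_distribution_axioms_def M_def)
  show "measure M {x} = 0" for x
  proof -
    have "emeasure M {x} = (\<integral>\<^sup>+ t. ennreal (h t) * indicator {x} t \<partial>lborel)"
      by (simp add: M_def emeasure_density)
    also have "\<dots> = (\<integral>\<^sup>+ t. 0 \<partial>(lborel :: real measure))"
    proof (rule nn_integral_cong_AE)
      show "AE t in lborel. ennreal (h t) * indicator {x} t = 0"
        using AE_lborel_singleton[of x] by eventually_elim auto
    qed
    finally show ?thesis by (simp add: measure_def)
  qed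
qed

section \<open>Measurability of the conditional cdfs and of the transform\<close>

lemma restrict_measurable_Leb [measurable]:
  "d \<le> p \<Longrightarrow> (\<lambda>x. restrict x {..<d}) \<in> measurable (Leb p) (Leb d)"
  by (rule measurable_restrict_subset) auto

text \<open>Joint measurability in the conditioning vector and the argument comes from writing the
  cdf as a parameter integral of the conditional density, cut off by the indicator of
  \<open>{..t}\<close>.\<close>

lemma cond_cdf_measurable:
  assumes "conditional_densities p gd" "d < p"
  shows "(\<lambda>(y, t). cond_cdf gd d y t) \<in> borel_measurable (Leb d \<Otimes>\<^sub>M lborel)"
proof -
  have [measurable]: "(\<lambda>(y, t). gd d y t) \<in> borel_measurable (Leb d \<Otimes>\<^sub>M lborel)"
    using assms by (auto simp: conditional_densities_def)
  have "cond_cdf gd d y t = enn2real (\<integral>\<^sup>+ s. ennreal (gd d y s) * indicator {..t} s \<partial>lborel)"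
    if "y \<in> space (Leb d)" for y t
  proof -
    have [measurable]: "gd d y \<in> borel_measurable lborel"
      using measurable_compose[OF measurable_Pair1'[OF that], of "\<lambda>(y, t). gd d y t" borel] by simp
    show ?thesis
      by (simp add: cond_cdf_def cdf_def measure_def emeasure_density)
  qed
  moreover have "(\<lambda>(y, t). enn2real (\<integral>\<^sup>+ s. ennreal (gd d y s) * indicator {..t} s \<partial>lborel))
      \<in> borel_measurable (Leb d \<Otimes>\<^sub>M lborel)"
    unfolding atMost_def indicator_def by measurable
  ultimately show ?thesis
    by (subst measurable_cong[where g="\<lambda>(y, t). enn2real (\<integral>\<^sup>+ s. ennreal (gd d y s) * indicator {..t} s \<partial>lborel)"])
      (auto simp: space_pair_measure)
qed

lemma measurable_restrict_component:
  assumes "(\<lambda>(y, t). h y t) \<in> borel_measurable (Leb d \<Otimes>\<^sub>M lborel)" "d < q"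
  shows "(\<lambda>x. h (restrict x {..<d}) (x d)) \<in> borel_measurable (Leb q)"
proof -
  have "(\<lambda>x. (restrict x {..<d}, x d)) \<in> measurable (Leb q) (Leb d \<Otimes>\<^sub>M lborel)"
    using assms(2) by (intro measurable_Pair restrict_measurable_Leb measurable_component_singleton) auto
  from measurable_compose[OF this assms(1)] show ?thesis by simp
qed

lemma chain_density_measurable [measurable]:
  assumes "conditional_densities p gd" "q \<le> p"
  shows "chain_density gd q \<in> borel_measurable (Leb q)"
proof -
  have "(\<lambda>x. gd d (restrict x {..<d}) (x d)) \<in> borel_measurable (Leb q)" if "d < q" for d
    using assms that by (intro measurable_restrict_component) (auto simp: conditional_densities_def)
  then have "(\<lambda>x. chain_density gd q x) \<in> borel_measurable (Leb q)"
    unfolding chain_density_def by (intro borel_measurable_prod) auto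
  then show ?thesis by simp
qed

lemma rosenblatt_component_measurable:
  assumes "conditional_densities p gd" "q \<le> p" "d < q"
  shows "(\<lambda>x. rosenblatt gd q x d) \<in> borel_measurable (Leb q)"
  unfolding rosenblatt_def using assms
  by (simp add: measurable_restrict_component cond_cdf_measurable[of p])

lemma rosenblatt_measurable:
  assumes "conditional_densities p gd" "q \<le> p"
  shows "rosenblatt gd q \<in> measurable (Leb q) (Pi\<^sub>M {..<q} (\<lambda>_. unif01))"
proof -
  have "(\<lambda>x. cond_cdf gd d (restrict x {..<d}) (x d)) \<in> borel_measurable (Leb q)" if "d < q" for d
    using rosenblatt_component_measurable[OF assms that] that by (simp add: rosenblatt_def)
  then show ?thesis
    unfolding rosenblatt_def[abs_def] by (intro measurable_restrict) auto
qed

section \<open>Uniformity of the Rosenblatt transform\<close>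

lemma chain_density_nonneg:
  assumes "conditional_densities p gd" "q \<le> p"
  shows "0 \<le> chain_density gd q x"
  unfolding chain_density_def using assms
  by (intro prod_nonneg) (auto simp: conditional_densities_def space_PiM)

lemma chain_density_Suc_upd:
  assumes "x \<in> space (Leb q)"
  shows "chain_density gd (Suc q) (x(q := t)) = chain_density gd q x * gd q x t"
proof -
  have "restrict (x(q := t)) {..<d} = restrict x {..<d}" if "d \<le> q" for d
    using that by (auto simp: restrict_def)
  moreover have "restrict x {..<q} = x"
    using assms by (auto simp: space_PiM PiE_restrict)
  ultimately show ?thesis by (simp add: chain_density_def)
qed

text \<open>Induction on the dimension: given the earlier components, the last component of the
  transform is uniform, so integrating it out yields a factor that does not depend on them. Test
  functions of product form survive this step and are enough to identify the law.\<close>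

lemma nn_integral_rosenblatt:
  assumes cond: "conditional_densities p gd" and "q \<le> p"
    and \<phi>: "\<And>d. \<phi> d \<in> borel_measurable borel"
  shows "(\<integral>\<^sup>+ x. ennreal (chain_density gd q x) * (\<Prod>d<q. \<phi> d (rosenblatt gd q x d)) \<partial>Leb q)
    = (\<Prod>d<q. \<integral>\<^sup>+ u. \<phi> d u \<partial>unif01)"
  using \<open>q \<le> p\<close>
proof (induction q)
  case 0
  then show ?case by (simp add: chain_density_def space_PiM nn_integral_count_space_finite PiM_empty)
next
  case (Suc q)
  interpret product_sigma_finite "\<lambda>_::nat. lborel :: real measure" ..
  note \<phi> [measurable]
  have ins: "{..<Suc q} = insert q {..<q}" by auto
  let ?R = "rosenblatt gd q"
  have R: "rosenblatt gd (Suc q) (x(q := t)) d = (if d = q then cond_cdf gd q x t else ?R x d)"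
    if "x \<in> space (Leb q)" "d < Suc q" for x t d
  proof -
    have "restrict (x(q := t)) {..<d} = restrict x {..<d}"
      using that(2) by (auto simp: restrict_def)
    moreover have "restrict x {..<q} = x"
      using that by (auto simp: space_PiM PiE_restrict)
    ultimately show ?thesis using that by (simp add: rosenblatt_def)
  qed
  have [measurable]: "rosenblatt gd (Suc q) \<in> measurable (Leb (Suc q)) (Pi\<^sub>M {..<Suc q} (\<lambda>_. unif01))"
    using cond Suc.prems by (rule rosenblatt_measurable)
  have [measurable]: "(\<lambda>x. \<phi> d (rosenblatt gd (Suc q) x d)) \<in> borel_measurable (Leb (Suc q))" if "d < Suc q" for d
    using that cond Suc.prems by (intro measurable_compose[OF _ \<phi>] rosenblatt_component_measurable) auto
  have [measurable]: "chain_density gd (Suc q) \<in> borel_measurable (Leb (Suc q))"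
    "chain_density gd q \<in> borel_measurable (Leb q)"
    using cond Suc.prems by (auto intro: chain_density_measurable)
  have [measurable]: "?R \<in> measurable (Leb q) (Pi\<^sub>M {..<q} (\<lambda>_. unif01))"
    using cond Suc.prems by (intro rosenblatt_measurable) auto
  have [measurable]: "(\<lambda>x. \<phi> d (?R x d)) \<in> borel_measurable (Leb q)" if "d < q" for d
    using that cond Suc.prems by (intro measurable_compose[OF _ \<phi>] rosenblatt_component_measurable) auto
  have inner: "(\<integral>\<^sup>+ t. ennreal (chain_density gd (Suc q) (x(q := t))) *
        (\<Prod>d<Suc q. \<phi> d (rosenblatt gd (Suc q) (x(q := t)) d)) \<partial>lborel)
      = ennreal (chain_density gd q x) * (\<Prod>d<q. \<phi> d (?R x d)) * (\<integral>\<^sup>+ u. \<phi> q u \<partial>unif01)"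
    if x: "x \<in> space (Leb q)" for x
  proof -
    have gq: "(\<lambda>(y, t). gd q y t) \<in> borel_measurable (Leb q \<Otimes>\<^sub>M lborel)" "\<And>t. 0 \<le> gd q x t"
      using cond Suc.prems x by (auto simp: conditional_densities_def)
    have [measurable]: "gd q x \<in> borel_measurable borel"
      using measurable_compose[OF measurable_Pair1'[OF x] gq(1)] by simp
    have [measurable]: "cond_cdf gd q x \<in> borel_measurable borel"
      using measurable_compose[OF measurable_Pair1'[OF x] cond_cdf_measurable[OF cond, of q]] Suc.prems by simp
    have nn: "0 \<le> chain_density gd q x"
      using cond Suc.prems by (intro chain_density_nonneg) auto
    have "(\<integral>\<^sup>+ t. ennreal (chain_density gd (Suc q) (x(q := t))) *
        (\<Prod>d<Suc q. \<phi> d (rosenblatt gd (Suc q) (x(q := t)) d)) \<partial>lborel)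
      = (\<integral>\<^sup>+ t. (ennreal (chain_density gd q x) * (\<Prod>d<q. \<phi> d (?R x d))) *
          (ennreal (gd q x t) * \<phi> q (cond_cdf gd q x t)) \<partial>lborel)"
      using x nn gq(2) by (intro nn_integral_cong) (simp add: R chain_density_Suc_upd ennreal_mult mult_ac)
    also have "\<dots> = ennreal (chain_density gd q x) * (\<Prod>d<q. \<phi> d (?R x d)) *
        (\<integral>\<^sup>+ t. ennreal (gd q x t) * \<phi> q (cond_cdf gd q x t) \<partial>lborel)"
      by (rule nn_integral_cmult) simp
    also have "\<dots> = ennreal (chain_density gd q x) * (\<Prod>d<q. \<phi> d (?R x d)) * (\<integral>\<^sup>+ u. \<phi> q u \<partial>unif01)"
    \<comment> \<open>Where the density of the earlier components vanishes, both sides are 0.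
      Elsewhere \<open>conditional_densities\<close> supplies the normalization that the probability
      integral transform requires.\<close>
    proof (cases "chain_density gd q x = 0")
      case False
      let ?M = "density lborel (\<lambda>t. ennreal (gd q x t))"
      have "distr ?M borel (cond_cdf gd q x) = unif01"
        unfolding cond_cdf_def
        using cond Suc.prems x nn False gq(2) 
        by (intro distr_cdf_density) (auto simp: conditional_densities_def)
      then have "(\<integral>\<^sup>+ u. \<phi> q u \<partial>unif01) = (\<integral>\<^sup>+ u. \<phi> q u \<partial>distr ?M borel (cond_cdf gd q x))"
        by simp
      also have "\<dots> = (\<integral>\<^sup>+ t. \<phi> q (cond_cdf gd q x t) \<partial>?M)"
        by (intro nn_integral_distr) simp_all
      also have "\<dots> = (\<integral>\<^sup>+ t. ennreal (gd q x t) * \<phi> q (cond_cdf gd q x t) \<partial>lborel)"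
        by (intro nn_integral_density) simp_all
      finally show ?thesis by simp
    qed simp
    finally show ?thesis .
  qed
  have "(\<integral>\<^sup>+ x. ennreal (chain_density gd (Suc q) x) * (\<Prod>d<Suc q. \<phi> d (rosenblatt gd (Suc q) x d)) \<partial>Leb (Suc q))
    = (\<integral>\<^sup>+ x. \<integral>\<^sup>+ t. ennreal (chain_density gd (Suc q) (x(q := t))) *
        (\<Prod>d<Suc q. \<phi> d (rosenblatt gd (Suc q) (x(q := t)) d)) \<partial>lborel \<partial>Leb q)"
    unfolding ins
    by (intro product_nn_integral_insert) (auto simp: ins[symmetric])
  also have "\<dots> = (\<integral>\<^sup>+ x. ennreal (chain_density gd q x) * (\<Prod>d<q. \<phi> d (?R x d)) *
      (\<integral>\<^sup>+ u. \<phi> q u \<partial>unif01) \<partial>Leb q)"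
    by (intro nn_integral_cong inner)
  also have "\<dots> = (\<integral>\<^sup>+ x. ennreal (chain_density gd q x) * (\<Prod>d<q. \<phi> d (?R x d)) \<partial>Leb q) *
      (\<integral>\<^sup>+ u. \<phi> q u \<partial>unif01)"
    by (intro nn_integral_multc) simp
  also have "\<dots> = (\<Prod>d<Suc q. \<integral>\<^sup>+ u. \<phi> d u \<partial>unif01)"
    using Suc by simp
  finally show ?case .
qed

text \<open>A measure on the finite product is determined by its values on boxes, and indicators of
  boxes are products of one-dimensional test functions.\<close>

lemma distr_rosenblatt:
  assumes cond: "conditional_densities p gd" and q: "q \<le> p"
  shows "distr (density (Leb q) (\<lambda>x. ennreal (chain_density gd q x))) (Pi\<^sub>M {..<q} (\<lambda>_. unif01)) (rosenblatt gd q)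
    = Pi\<^sub>M {..<q} (\<lambda>_. unif01)"
proof -
  interpret u: prob_space unif01 by (rule prob_space_unif01)
  interpret product_prob_space "\<lambda>_::nat. unif01" ..
  have [measurable]: "rosenblatt gd q \<in> measurable (Leb q) (Pi\<^sub>M {..<q} (\<lambda>_. unif01))"
    using cond q by (rule rosenblatt_measurable)
  have [measurable]: "chain_density gd q \<in> borel_measurable (Leb q)"
    using cond q by (auto intro: chain_density_measurable)
  show ?thesis
  proof (rule PiM_eqI)
    fix A :: "nat \<Rightarrow> real set"
    assume A: "\<And>i. i \<in> {..<q} \<Longrightarrow> A i \<in> sets unif01"
    \<comment> \<open>The sets \<open>A d\<close> with \<open>d \<ge> q\<close> are unconstrained;
      the value 0 there makes every \<open>\<phi> d\<close> measurable.\<close>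
    define \<phi> :: "nat \<Rightarrow> real \<Rightarrow> ennreal" where "\<phi> d = (if d < q then indicator (A d) else (\<lambda>_. 0))" for d
    have \<phi>: "\<phi> d \<in> borel_measurable borel" for d
      using A by (auto simp: \<phi>_def)
    have B: "Pi\<^sub>E {..<q} A \<in> sets (Pi\<^sub>M {..<q} (\<lambda>_. unif01))"
      using A by (intro sets_PiM_I_finite) auto
    have "emeasure (distr (density (Leb q) (\<lambda>x. ennreal (chain_density gd q x))) (Pi\<^sub>M {..<q} (\<lambda>_. unif01)) (rosenblatt gd q)) (Pi\<^sub>E {..<q} A)
      = (\<integral>\<^sup>+ x. ennreal (chain_density gd q x) * indicator (rosenblatt gd q -` Pi\<^sub>E {..<q} A \<inter> space (Leb q)) x \<partial>Leb q)"
      using B by (subst emeasure_distr) (auto simp: emeasure_density measurable_sets)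
    also have "\<dots> = (\<integral>\<^sup>+ x. ennreal (chain_density gd q x) * (\<Prod>d<q. \<phi> d (rosenblatt gd q x d)) \<partial>Leb q)"
    proof (intro nn_integral_cong)
      fix x assume x: "x \<in> space (Leb q)"
      have "rosenblatt gd q x \<in> extensional {..<q}" by (simp add: rosenblatt_def)
      then have "indicator (rosenblatt gd q -` Pi\<^sub>E {..<q} A \<inter> space (Leb q)) x = (\<Prod>d<q. \<phi> d (rosenblatt gd q x d))"
        using x by (auto simp: \<phi>_def indicator_def PiE_def Pi_def prod_zero_iff)
      then show "ennreal (chain_density gd q x) * indicator (rosenblatt gd q -` Pi\<^sub>E {..<q} A \<inter> space (Leb q)) x
         = ennreal (chain_density gd q x) * (\<Prod>d<q. \<phi> d (rosenblatt gd q x d))" by simp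
    qed
    also have "\<dots> = (\<Prod>d<q. \<integral>\<^sup>+ u. \<phi> d u \<partial>unif01)"
      using cond q \<phi> by (rule nn_integral_rosenblatt)
    also have "\<dots> = (\<Prod>d<q. emeasure unif01 (A d))"
      using A by (intro prod.cong refl) (simp add: \<phi>_def)
    finally show "emeasure (distr (density (Leb q) (\<lambda>x. ennreal (chain_density gd q x))) (Pi\<^sub>M {..<q} (\<lambda>_. unif01)) (rosenblatt gd q)) (Pi\<^sub>E {..<q} A)
      = (\<Prod>d\<in>{..<q}. emeasure unif01 (A d))" .
  qed auto
qed

text \<open>The total mass is read off the image measure, which is the uniform law on the
  cube.\<close>

lemma prob_space_chain_density:
  assumes "conditional_densities p gd" "q \<le> p"
  shows "prob_space (density (Leb q) (\<lambda>x. ennreal (chain_density gd q x)))"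
proof (rule prob_space_distrD)
  show "rosenblatt gd q \<in> measurable (density (Leb q) (\<lambda>x. ennreal (chain_density gd q x)))
      (Pi\<^sub>M {..<q} (\<lambda>_. unif01))"
    using rosenblatt_measurable[OF assms] by (simp only: measurable_density_eq1)
  show "prob_space (distr (density (Leb q) (\<lambda>x. ennreal (chain_density gd q x)))
      (Pi\<^sub>M {..<q} (\<lambda>_. unif01)) (rosenblatt gd q))"
    unfolding distr_rosenblatt[OF assms] by (intro prob_space_PiM prob_space_unif01)
qed

text \<open>Lower orthants are stable under intersection, generate the product sigma-algebra, and
  countably many of them cover the space.\<close>

lemma measure_eqI_joint_cdf:
  assumes M: "prob_space M" "sets M = sets (Leb q)" and N: "prob_space N" "sets N = sets (Leb q)"
    and eq: "joint_cdf q M = joint_cdf q N"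
  shows "M = N"
proof -
  let ?\<Omega> = "Pi\<^sub>E {..<q} (\<lambda>_. UNIV :: real set)"
  define Q where "Q y = {x \<in> ?\<Omega>. \<forall>d<q. x d \<le> y d}" for y :: "nat \<Rightarrow> real"
  interpret M: prob_space M by fact
  interpret N: prob_space N by fact
  have sp: "space M = ?\<Omega>" "space N = ?\<Omega>"
    using sets_eq_imp_space_eq[OF M(2)] sets_eq_imp_space_eq[OF N(2)] by (simp_all add: space_PiM)
  have "sets (Leb q) = sets (Pi\<^sub>M {..<q} (\<lambda>_. sigma UNIV (range atMost)))"
    by (intro sets_PiM_cong refl) (simp add: borel_eq_atMost)
  also have "\<dots> = sets (sigma ?\<Omega> {{f \<in> ?\<Omega>. \<forall>i\<in>j. f i \<in> A i} |A j.
      j \<in> {{..<q}} \<and> A \<in> Pi j (\<lambda>_. range atMost)})"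
  proof (rule sets_PiM_sigma)
    have "(UNIV :: real set) = \<Union>(atMost ` range real)"
      using real_nat_ceiling_ge by auto
    then show "\<exists>S\<subseteq>range atMost. countable S \<and> (UNIV :: real set) = \<Union> S"
      by (intro exI[of _ "atMost ` range real"]) auto
  qed auto
  also have "{{f \<in> ?\<Omega>. \<forall>i\<in>j. f i \<in> A i} |A j. j \<in> {{..<q}} \<and> A \<in> Pi j (\<lambda>_. range atMost)} = range Q"
  proof (intro equalityI subsetI)
    fix S assume "S \<in> {{f \<in> ?\<Omega>. \<forall>i\<in>j. f i \<in> A i} |A j. j \<in> {{..<q}} \<and> A \<in> Pi j (\<lambda>_. range atMost)}"
    then obtain A where A: "S = {f \<in> ?\<Omega>. \<forall>i\<in>{..<q}. f i \<in> A i}"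
        and "A \<in> {..<q} \<rightarrow> range (atMost :: real \<Rightarrow> _)"
      by auto
    then have "\<forall>i\<in>{..<q}. \<exists>y. A i = {..y}" by (auto simp: Pi_iff image_iff)
    then obtain y where "\<forall>i\<in>{..<q}. A i = {..y i}" by metis
    with A show "S \<in> range Q" by (auto simp: Q_def)
  next
    fix S assume "S \<in> range Q"
    then obtain y where "S = {f \<in> ?\<Omega>. \<forall>i\<in>{..<q}. f i \<in> {..y i}}" by (auto simp: Q_def)
    then show "S \<in> {{f \<in> ?\<Omega>. \<forall>i\<in>j. f i \<in> A i} |A j. j \<in> {{..<q}} \<and> A \<in> Pi j (\<lambda>_. range atMost)}"
      by (intro CollectI exI[of _ "\<lambda>i. {..y i}"] exI[of _ "{..<q}"]) auto
  qed
  finally have gen: "sets (Leb q) = sigma_sets ?\<Omega> (range Q)"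
    by (simp add: Q_def subset_eq)
  show ?thesis
  proof (rule measure_eqI_generator_eq)
    have "Q y \<inter> Q z = Q (\<lambda>d. min (y d) (z d))" for y z by (auto simp: Q_def)
    then show "Int_stable (range Q)" by (auto simp: Int_stable_def)
    show "emeasure M X = emeasure N X" if "X \<in> range Q" for X
      using that fun_cong[OF eq] sp
      by (auto simp: joint_cdf_def Q_def M.emeasure_eq_measure N.emeasure_eq_measure)
    show "(\<Union>n. Q (\<lambda>_. real n)) = ?\<Omega>"
    proof (intro equalityI subsetI)
      fix x assume x: "x \<in> ?\<Omega>"
      \<comment> \<open>Inserting 0 keeps the maximum over a nonempty set when
        \<open>q = 0\<close>.\<close>
      obtain n where n: "\<bar>Max (insert 0 (x ` {..<q}))\<bar> \<le> real n" using real_arch_simple by blast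
      have "x d \<le> real n" if "d < q" for d
        using n that Max_ge[of "insert 0 (x ` {..<q})" "x d"] by simp
      then show "x \<in> (\<Union>n. Q (\<lambda>_. real n))" using x by (auto simp: Q_def)
    qed (auto simp: Q_def)
  qed (use M N gen in \<open>auto simp: Q_def\<close>)
qed

section \<open>Application to the test statistic\<close>

text \<open>For positive variance the central limit theorem and Levy continuity apply, and
  evaluating the characteristic function at \<open>sqrt v\<close> undoes the standardization. The
  degenerate case \<open>v = 0\<close>, as for a zero coefficient vector, is separate: all summands
  vanish almost surely.\<close>

lemma (in prob_space) char_iid_sum_tendsto:
  fixes Y :: "nat \<Rightarrow> 'a \<Rightarrow> real"
  assumes indep: "indep_vars (\<lambda>_. borel) Y UNIV"
    and distr: "\<And>i. distr M borel (Y i) = \<mu>"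
    and mean: "\<And>i. expectation (Y i) = 0"
    and int: "\<And>i. integrable M (\<lambda>\<omega>. (Y i \<omega>)\<^sup>2)"
    and var: "\<And>i. expectation (\<lambda>\<omega>. (Y i \<omega>)\<^sup>2) = v"
  shows "(\<lambda>n. \<integral>\<omega>. iexp ((\<Sum>i<n. Y i \<omega>) / sqrt (real n)) \<partial>M) \<longlonglongrightarrow> complex_of_real (exp (- v / 2))"
proof -
  have [measurable]: "Y i \<in> borel_measurable M" for i
    using indep unfolding indep_vars_def2 by simp
  have "0 \<le> v" unfolding var[of 0, symmetric] by simp
  show ?thesis
  proof (cases "v = 0")
    case True
    have "AE \<omega> in M. Y i \<omega> = 0" for i
      using integral_nonneg_eq_0_iff_AE[OF int[of i]] var[of i] True by simp
    then have "AE \<omega> in M. \<forall>i. Y i \<omega> = 0" by (simp add: AE_all_countable)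
    then have "(\<integral>\<omega>. iexp ((\<Sum>i<n. Y i \<omega>) / sqrt (real n)) \<partial>M) = (\<integral>\<omega>. 1 \<partial>M)" for n
      by (intro integral_cong_AE) auto
    then show ?thesis using True by (simp add: prob_space)
  next
    case False
    define S where "S n \<omega> = (\<Sum>i<n. Y i \<omega>)" for n \<omega>
    have [measurable]: "S n \<in> borel_measurable M" for n unfolding S_def by simp
    have v: "(sqrt v)\<^sup>2 = v" using \<open>0 \<le> v\<close> by simp
    have "weak_conv_m (\<lambda>n. distr M borel (\<lambda>\<omega>. S n \<omega> / sqrt (real n * (sqrt v)\<^sup>2))) std_normal_distribution"
      unfolding S_def
      using False \<open>0 \<le> v\<close> by (intro central_limit_theorem_zero_mean[OF indep mean _ int _ distr]) (simp_all add: mean var)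
    then have "(\<lambda>n. char (distr M borel (\<lambda>\<omega>. S n \<omega> / sqrt (real n * v))) (sqrt v))
        \<longlonglongrightarrow> char std_normal_distribution (sqrt v)"
      unfolding v by (intro levy_continuity1 real_distribution_distr real_dist_normal_dist) auto
    moreover have "char (distr M borel (\<lambda>\<omega>. S n \<omega> / sqrt (real n * v))) (sqrt v)
        = (\<integral>\<omega>. iexp (S n \<omega> / sqrt (real n)) \<partial>M)" for n
    proof -
      have "sqrt v * (x / sqrt (real n * v)) = x / sqrt (real n)" for x
        using False by (simp add: real_sqrt_mult)
      then show ?thesis unfolding char_def by (subst integral_distr) (simp_all flip: of_real_mult of_real_divide)
    qed
    ultimately show ?thesis
      unfolding char_std_normal_distribution v by (simp add: S_def)
  qed
qed

section \<open>Tensor products of Legendre polynomials\<close>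

lemma tensor_legendre_measurable:
  "tensor_legendre q k \<in> borel_measurable (Pi\<^sub>M {..<q} (\<lambda>_. unif01))"
proof -
  have "(\<lambda>u. legendre (k d) (u d)) \<in> borel_measurable (Pi\<^sub>M {..<q} (\<lambda>_. unif01))" if "d < q" for d
    unfolding legendre_def
    using that measurable_compose[OF measurable_component_singleton[of d "{..<q}" "\<lambda>_. unif01"],
      of "poly ((pderiv ^^ k d) ([:0, -1, 1:] ^ k d))" borel] by simp
  then have "(\<lambda>u. tensor_legendre q k u) \<in> borel_measurable (Pi\<^sub>M {..<q} (\<lambda>_. unif01))"
    unfolding tensor_legendre_def by (intro borel_measurable_prod) auto
  then show ?thesis by simp
qed

lemma integrable_legendre_mult: "integrable unif01 (\<lambda>u. legendre i u * legendre j u)"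
  unfolding legendre_def by (intro integrable_unif01_continuous continuous_intros)

lemma integrable_tensor_legendre_mult:
  "integrable (Pi\<^sub>M {..<q} (\<lambda>_. unif01)) (\<lambda>u. tensor_legendre q k u * tensor_legendre q l u)"
proof -
  interpret u: prob_space unif01 by (rule prob_space_unif01)
  interpret product_prob_space "\<lambda>_::nat. unif01" ..
  show ?thesis
    unfolding tensor_legendre_def prod.distrib[symmetric]
    by (intro product_integrable_prod integrable_legendre_mult) simp
qed

lemma tensor_legendre_orthonormal:
  "(\<integral>u. tensor_legendre q k u * tensor_legendre q l u \<partial>Pi\<^sub>M {..<q} (\<lambda>_. unif01))
    = (if \<forall>d<q. k d = l d then 1 else 0)"
proof -
  interpret u: prob_space unif01 by (rule prob_space_unif01)
  interpret product_prob_space "\<lambda>_::nat. unif01" ..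
  have "(\<integral>u. tensor_legendre q k u * tensor_legendre q l u \<partial>Pi\<^sub>M {..<q} (\<lambda>_. unif01))
      = (\<Prod>d<q. \<integral>u. legendre (k d) u * legendre (l d) u \<partial>unif01)"
    unfolding tensor_legendre_def prod.distrib[symmetric]
    by (intro product_integral_prod integrable_legendre_mult) simp
  then show ?thesis by (auto simp: legendre_orthonormal prod_zero_iff)
qed

text \<open>Pairing with the zero index turns the statements on products into integrability and the
  mean of a single tensor polynomial.\<close>

lemma tensor_legendre_0: "tensor_legendre q (\<lambda>_. 0) u = 1"
  by (simp add: tensor_legendre_def legendre_0)

lemma integrable_tensor_legendre: "integrable (Pi\<^sub>M {..<q} (\<lambda>_. unif01)) (tensor_legendre q k)"
  using integrable_tensor_legendre_mult[of q k "\<lambda>_. 0"] by (simp add: tensor_legendre_0)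

lemma integral_tensor_legendre:
  "(\<integral>u. tensor_legendre q k u \<partial>Pi\<^sub>M {..<q} (\<lambda>_. unif01)) = (if \<forall>d<q. k d = 0 then 1 else 0)"
  using tensor_legendre_orthonormal[of q k "\<lambda>_. 0"] by (simp add: tensor_legendre_0)

section \<open>Index sets and reduction to the first \<open>q\<close> components\<close>

lemma finite_sub_index_set: "finite (sub_index_set p m q)"
  unfolding sub_index_set_def index_set_def by (simp add: finite_PiE)

lemma sub_index_set_nonzero:
  assumes "k \<in> sub_index_set p m q"
  shows "\<exists>d<q. k d \<noteq> 0"
proof -
  obtain d where d: "d < p" "k d \<noteq> 0" using assms by (auto simp: sub_index_set_def index_set_def)
  then have "d < q" using assms by (cases "d < q") (simp_all add: sub_index_set_def)
  with d show ?thesis by auto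
qed

text \<open>Restriction to the first \<open>q\<close> entries is a bijection onto the nonzero tuples
  of length \<open>q\<close>, with padding by zeros as inverse; the subtracted 1 is the zero
  tuple.\<close>

lemma card_sub_index_set:
  assumes "q \<le> p"
  shows "card (sub_index_set p m q) = (\<Prod>d<q. m d + 1) - 1"
proof -
  let ?E = "\<Pi>\<^sub>E d\<in>{..<q}. {..m d}" and ?z = "\<lambda>d\<in>{..<q}. 0"
  have "bij_betw (\<lambda>k. restrict k {..<q}) (sub_index_set p m q) (?E - {?z})"
  proof (rule bij_betw_byWitness[where f'="\<lambda>k. \<lambda>d\<in>{..<p}. if d < q then k d else 0"])
    show "\<forall>k\<in>sub_index_set p m q. (\<lambda>d\<in>{..<p}. if d < q then restrict k {..<q} d else 0) = k"
      unfolding sub_index_set_def index_set_def by (auto simp: fun_eq_iff restrict_def PiE_def extensional_def)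
    show "\<forall>k\<in>?E - {?z}. restrict (\<lambda>d\<in>{..<p}. if d < q then k d else 0) {..<q} = k"
      using assms by (auto simp: fun_eq_iff restrict_def PiE_def extensional_def)
    show "(\<lambda>k. restrict k {..<q}) ` sub_index_set p m q \<subseteq> ?E - {?z}"
    proof (intro image_subsetI)
      fix k assume k: "k \<in> sub_index_set p m q"
      obtain d where "d < q" "k d \<noteq> 0" using sub_index_set_nonzero[OF k] by blast
      then have "restrict k {..<q} \<noteq> ?z" using \<open>k d \<noteq> 0\<close> by (auto dest: fun_cong[of _ _ d])
      then show "restrict k {..<q} \<in> ?E - {?z}"
        using k assms by (auto simp: sub_index_set_def index_set_def)
    qed
    show "(\<lambda>k. \<lambda>d\<in>{..<p}. if d < q then k d else 0) ` (?E - {?z}) \<subseteq> sub_index_set p m q"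
    proof (intro image_subsetI)
      fix k assume k: "k \<in> ?E - {?z}"
      have "\<exists>d<q. k d \<noteq> 0"
      proof (rule ccontr)
        assume "\<not> (\<exists>d<q. k d \<noteq> 0)"
        with k have "k = ?z" by (intro ext) (auto simp: PiE_def extensional_def)
        with k show False by simp
      qed
      then obtain d where "d < q" "k d \<noteq> 0" by blast
      with k assms have "\<exists>d<p. (\<lambda>d\<in>{..<p}. if d < q then k d else 0) d \<noteq> 0"
        by (intro exI[of _ d]) auto
      moreover have "(\<lambda>d\<in>{..<p}. if d < q then k d else 0) \<in> (\<Pi>\<^sub>E d\<in>{..<p}. {..m d})"
        using PiE_mem[of k "{..<q}" "\<lambda>d. {..m d}"] k by (intro PiE_I) auto
      ultimately show "(\<lambda>d\<in>{..<p}. if d < q then k d else 0) \<in> sub_index_set p m q"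
        unfolding sub_index_set_def index_set_def using assms by simp
    qed
  qed
  then have "card (sub_index_set p m q) = card (?E - {?z})" by (rule bij_betw_same_card)
  also have "\<dots> = card ?E - 1" by (simp add: finite_PiE)
  also have "card ?E = (\<Prod>d<q. m d + 1)" by (simp add: card_PiE)
  finally show ?thesis .
qed

text \<open>Factors from \<open>q\<close> on are \<open>legendre 0\<close>, hence 1, and the
  transform is triangular: its first \<open>q\<close> components depend only on the first
  \<open>q\<close> components of \<open>x\<close>.\<close>

lemma tensor_legendre_rosenblatt_restrict:
  assumes "k \<in> sub_index_set p m q" "q \<le> p"
  shows "tensor_legendre p k (rosenblatt gd p x) = tensor_legendre q k (rosenblatt gd q (restrict x {..<q}))"
proof -
  have "tensor_legendre p k (rosenblatt gd p x) = (\<Prod>d<q. legendre (k d) (rosenblatt gd p x d))"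
    unfolding tensor_legendre_def using assms
    by (intro prod.mono_neutral_right) (auto simp: sub_index_set_def legendre_0)
  also have "\<dots> = tensor_legendre q k (rosenblatt gd q (restrict x {..<q}))"
    unfolding tensor_legendre_def
  proof (intro prod.cong refl)
    fix d assume "d \<in> {..<q}"
    moreover from this have "{..<q} \<inter> {..<d} = {..<d}" by auto
    ultimately show "legendre (k d) (rosenblatt gd p x d) = legendre (k d) (rosenblatt gd q (restrict x {..<q}) d)"
      using assms by (simp add: rosenblatt_def)
  qed
  finally show ?thesis .
qed

text \<open>Passing from the selected indices to all of \<open>sub_index_set p m q\<close> only adds
  squares. The bound is pointwise, which is what makes the resulting p-value valid after a
  data-dependent selection.\<close>

lemma test_statistic_le:
  "test_statistic p m q n \<theta> rk r \<le> real n * (\<Sum>k\<in>sub_index_set p m q. (\<theta> k)\<^sup>2)"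
  unfolding test_statistic_def by (intro mult_left_mono sum_mono2 finite_sub_index_set) auto

text \<open>The null hypothesis equates only cdfs; uniqueness upgrades this to equality of laws, so
  the first \<open>q\<close> observed components have the postulated chain density.\<close>

lemma marginal_eq_chain_density:
  assumes "conditional_densities p gd" "q \<le> p"
    and f: "prob_space (density (Leb p) f)"
    and g: "marginal q (density (Leb p) g) = density (Leb q) (\<lambda>x. ennreal (chain_density gd q x))"
    and cdf: "joint_cdf q (marginal q (density (Leb p) g)) = joint_cdf q (marginal q (density (Leb p) f))"
  shows "marginal q (density (Leb p) f) = density (Leb q) (\<lambda>x. ennreal (chain_density gd q x))"
proof (rule measure_eqI_joint_cdf)
  show "prob_space (marginal q (density (Leb p) f))"
    unfolding marginal_def using \<open>q \<le> p\<close>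
    by (intro prob_space.prob_space_distr f) (simp add: restrict_measurable_Leb)
  show "prob_space (density (Leb q) (\<lambda>x. ennreal (chain_density gd q x)))"
    using assms by (intro prob_space_chain_density)
  show "joint_cdf q (marginal q (density (Leb p) f))
      = joint_cdf q (density (Leb q) (\<lambda>x. ennreal (chain_density gd q x)))"
    unfolding cdf[symmetric] g ..
qed (simp_all add: marginal_def)

theorem theorem5p1:
  fixes P :: "'a measure"
    and p q :: nat
    and X :: "nat \<Rightarrow> 'a \<Rightarrow> nat \<Rightarrow> real"
    and f g :: "(nat \<Rightarrow> real) \<Rightarrow> real"
    and gd :: "nat \<Rightarrow> (nat \<Rightarrow> real) \<Rightarrow> real \<Rightarrow> real"
    and m :: "nat \<Rightarrow> nat"
    and c :: criterion
    and rk :: "nat \<Rightarrow> 'a \<Rightarrow> (nat \<Rightarrow> nat) \<Rightarrow> nat"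
    and Kstar :: "nat \<Rightarrow> 'a \<Rightarrow> nat"
    and t :: real
  defines "\<theta> \<equiv> \<lambda>n \<omega>. theta_hat gd p n (\<lambda>i. X i \<omega>)"
  assumes q: "1 \<le> q" "q < p"
    and P: "prob_space P"
    and iid_indep: "prob_space.indep_vars P (\<lambda>_. Leb p) X UNIV"
    and iid_density: "\<And>i. distributed P (Leb p) (X i) (\<lambda>x. ennreal (f x))"
    and f_nonneg: "\<And>x. x \<in> space (Leb p) \<Longrightarrow> 0 \<le> f x"
    and cond: "conditional_densities p gd"
    and g: "\<And>x. x \<in> space (Leb p) \<Longrightarrow> g x = chain_density gd p x"
    and f_zero: "\<And>x. x \<in> space (Leb p) \<Longrightarrow> g x = 0 \<Longrightarrow> f x = 0"
    and L2: "L2_cube p (likelihood_ratio gd p f g)"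
    and m: "\<exists>d<p. m d \<noteq> 0"
    and rk_measurable:
      "\<And>n k. n > 0 \<Longrightarrow> k \<in> index_set p m \<Longrightarrow> (\<lambda>\<omega>. rk n \<omega> k) \<in> measurable P (count_space UNIV)"
    and rk: "\<And>n \<omega>. n > 0 \<Longrightarrow> \<omega> \<in> space P \<Longrightarrow> is_ranking (index_set p m) (\<theta> n \<omega>) (rk n \<omega>)"
    and Kstar_measurable: "\<And>n. n > 0 \<Longrightarrow> Kstar n \<in> measurable P (count_space UNIV)"
    and Kstar: "\<And>n \<omega>. n > 0 \<Longrightarrow> \<omega> \<in> space P \<Longrightarrow>
      is_selected_size c n (index_set p m) (\<theta> n \<omega>) (rk n \<omega>) (Kstar n \<omega>)"
    and g_q: "marginal q (density (Leb p) (\<lambda>x. ennreal (g x))) =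
      density (Leb q) (\<lambda>x. ennreal (chain_density gd q x))"
    and H0: "joint_cdf q (marginal q (density (Leb p) (\<lambda>x. ennreal (g x)))) =
      joint_cdf q (marginal q (density (Leb p) (\<lambda>x. ennreal (f x))))"
    and t: "0 \<le> t"
  shows "limsup (\<lambda>n. ereal (measure P {\<omega> \<in> space P.
      test_statistic p m q n (\<theta> n \<omega>) (rk n \<omega>) (Kstar n \<omega>) > t}))
    \<le> ereal (adjusted_p_value m q t)"
proof -
  interpret prob_space P by (rule P)
  let ?U = "Pi\<^sub>M {..<q} (\<lambda>_. unif01)"
  let ?K = "sub_index_set p m q"
  define N where "N = card ?K"
  have N: "adjusted_p_value m q t = measure (chi_squared N) {t<..}"
    using q by (simp add: adjusted_p_value_def N_def card_sub_index_set)
  \<comment> \<open>Under the null hypothesis these vectors are i.i.d. uniform on the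
    \<open>q\<close>-dimensional cube, as \<open>distrW\<close> and \<open>indepW\<close>
    record.\<close>
  define W where "W i \<omega> = rosenblatt gd q (restrict (X i \<omega>) {..<q})" for i \<omega>
  have R: "(\<lambda>x. rosenblatt gd q (restrict x {..<q})) \<in> measurable (Leb p) ?U"
    using q by (intro measurable_compose[OF restrict_measurable_Leb rosenblatt_measurable[OF cond]]) auto
  have X: "X i \<in> measurable P (Leb p)" for i
    using iid_density by (rule distributed_measurable)
  have W [measurable]: "W i \<in> measurable P ?U" for i
    unfolding W_def by (rule measurable_compose[OF X R])
  have "prob_space (density (Leb p) (\<lambda>x. ennreal (f x)))"
    unfolding distributed_distr_eq_density[OF iid_density[of 0], symmetric] by (rule prob_space_distr[OF X])
  then have marg: "marginal q (density (Leb p) (\<lambda>x. ennreal (f x))) = density (Leb q) (\<lambda>x. ennreal (chain_density gd q x))"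
    using q by (intro marginal_eq_chain_density[OF cond _ _ g_q H0]) auto
  have distrW: "distr P ?U (W i) = ?U" for i
  proof -
    have "distr P ?U (W i) = distr (distr (distr P (Leb p) (X i)) (Leb q) (\<lambda>x. restrict x {..<q})) ?U (rosenblatt gd q)"
      using q X restrict_measurable_Leb[of q p] rosenblatt_measurable[OF cond, of q]
      by (simp add: distr_distr W_def[abs_def] comp_def measurable_compose[OF X])
    also have "\<dots> = ?U"
      using q distr_rosenblatt[OF cond, of q] marg
      by (simp add: distributed_distr_eq_density[OF iid_density] marginal_def)
    finally show ?thesis .
  qed
  have indepW: "indep_vars (\<lambda>_. ?U) W UNIV"
    unfolding W_def[abs_def] by (rule indep_vars_compose2[OF iid_indep R])
  have test: "test_statistic p m q n (\<theta> n \<omega>) r K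
      \<le> (\<Sum>k\<in>?K. ((\<Sum>i<n. tensor_legendre q k (W i \<omega>)) / sqrt (real n))\<^sup>2)" for n \<omega> r K
  proof -
    \<comment> \<open>This also holds for \<open>n = 0\<close>, where both sides are 0 since
      division by zero yields 0.\<close>
    have "real n * (\<theta> n \<omega> k)\<^sup>2 = ((\<Sum>i<n. tensor_legendre q k (W i \<omega>)) / sqrt (real n))\<^sup>2" if "k \<in> ?K" for k
      using that q by (simp add: \<theta>_def theta_hat_def W_def tensor_legendre_rosenblatt_restrict[of k p m q]
        power_divide power2_eq_square[of "real n"])
    then have "real n * (\<Sum>k\<in>?K. (\<theta> n \<omega> k)\<^sup>2) = (\<Sum>k\<in>?K. ((\<Sum>i<n. tensor_legendre q k (W i \<omega>)) / sqrt (real n))\<^sup>2)"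
      by (simp add: sum_distrib_left)
    then show ?thesis using test_statistic_le[of p m q n "\<theta> n \<omega>" r K] by simp
  qed
  show ?thesis
  \<comment> \<open>\<open>N = 0\<close> means that \<open>m d = 0\<close> for all
    \<open>d < q\<close>. The statistic is then an empty sum, and as \<open>t \<ge> 0\<close> the
    event has probability 0.\<close>
  proof (cases "N = 0")
    case True
    then have "?K = {}" by (simp add: N_def finite_sub_index_set)
    then have "test_statistic p m q n (\<theta> n \<omega>) (rk n \<omega>) (Kstar n \<omega>) = 0" for n \<omega>
      by (simp add: test_statistic_def)
    then show ?thesis using t by (simp add: adjusted_p_value_def Limsup_const)
  next
    case False
    obtain h where h: "bij_betw h {..<N} ?K"
      using ex_bij_betw_nat_finite[OF finite_sub_index_set] unfolding N_def atLeast0LessThan by blast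
    define V where "V n j \<omega> = (\<Sum>i<n. tensor_legendre q (h j) (W i \<omega>)) / sqrt (real n)" for n j \<omega>
    have TW [measurable]: "(\<lambda>\<omega>. tensor_legendre q k (W i \<omega>)) \<in> borel_measurable P" for k i
      by (rule measurable_compose[OF W tensor_legendre_measurable])
    have V [measurable]: "V n j \<in> borel_measurable P" for n j
      unfolding V_def by simp
    have hK: "h j \<in> ?K" if "j < N" for j using h that by (auto dest: bij_betwE)
    \<comment> \<open>Agreement on the first \<open>q\<close> entries is agreement everywhere:
      entries from \<open>q\<close> to \<open>p - 1\<close> are 0 and later ones are
      \<open>undefined\<close>.\<close>
    have ortho: "(\<forall>d<q. h i d = h j d) \<longleftrightarrow> i = j" if "i < N" "j < N" for i j
    proof
      assume *: "\<forall>d<q. h i d = h j d"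
      have "h i = h j"
      proof
        fix d show "h i d = h j d"
          using * hK[OF that(1)] hK[OF that(2)]
          by (cases "d < q"; cases "d < p") (auto simp: sub_index_set_def index_set_def PiE_def extensional_def)
      qed
      then show "i = j" using h that by (auto simp: bij_betw_def inj_on_def)
    qed simp
    have nonzero: "\<not> (\<forall>d<q. h j d = 0)" if j: "j < N" for j
      using sub_index_set_nonzero[OF hK[OF j]] by simp
    have char: "(\<lambda>n. \<integral>\<omega>. iexp (\<Sum>j<N. a j * V n j \<omega>) \<partial>P)
        \<longlonglongrightarrow> complex_of_real (exp (- (\<Sum>j<N. (a j)\<^sup>2) / 2))" for a
    proof -
      \<comment> \<open>A linear combination of the \<open>V n j\<close> is again a normalized
        i.i.d. sum, with summands \<open>y (W i \<omega>)\<close>. Orthonormality gives them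
        variance \<open>\<Sum>j<N. (a j)^2\<close>, and mean 0 because no index \<open>h j\<close>
        is zero.\<close>
      define y where "y u = (\<Sum>j<N. a j * tensor_legendre q (h j) u)" for u
      have y [measurable]: "y \<in> borel_measurable ?U"
        unfolding y_def
        by (intro borel_measurable_sum borel_measurable_times borel_measurable_const tensor_legendre_measurable)
      have sq: "(y u)\<^sup>2 = (\<Sum>i<N. \<Sum>j<N. a i * a j * (tensor_legendre q (h i) u * tensor_legendre q (h j) u))" for u
        unfolding y_def power2_eq_square sum_product by (simp add: mult_ac)
      have int: "integrable ?U (\<lambda>u. (y u)\<^sup>2)"
        unfolding sq using integrable_tensor_legendre_mult by simp
      have "(\<integral>u. y u \<partial>?U) = 0"
      proof -
        have "(\<integral>u. y u \<partial>?U) = (\<Sum>j<N. a j * (if \<forall>d<q. h j d = 0 then 1 else 0))"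
          unfolding y_def by (simp add: integrable_tensor_legendre integral_tensor_legendre)
        also have "\<dots> = (\<Sum>j<N. 0)"
          by (intro sum.cong refl) (simp only: if_not_P[OF nonzero] lessThan_iff mult_zero_right)
        also have "\<dots> = 0" by simp
        finally show ?thesis .
      qed
      then have mean: "expectation (\<lambda>\<omega>. y (W i \<omega>)) = 0" for i
        using integral_distr[OF W y, of i] unfolding distrW by (rule trans[OF sym, rotated])
      have y2: "(\<lambda>u. (y u)\<^sup>2) \<in> borel_measurable ?U" using y by (rule borel_measurable_power)
      have "(\<integral>u. (y u)\<^sup>2 \<partial>?U) = (\<Sum>i<N. \<Sum>j<N. a i * a j * (if i = j then 1 else 0))"
        unfolding sq using ortho by (simp add: integrable_tensor_legendre_mult tensor_legendre_orthonormal)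
      also have "\<dots> = (\<Sum>j<N. (a j)\<^sup>2)"
        by (simp add: if_distrib[of "(*) _"] sum.delta power2_eq_square cong: if_cong)
      finally have var: "expectation (\<lambda>\<omega>. (y (W i \<omega>))\<^sup>2) = (\<Sum>j<N. (a j)\<^sup>2)" for i
        using integral_distr[OF W y2, of i] unfolding distrW by (rule trans[OF sym, rotated])
      have "(\<lambda>n. \<integral>\<omega>. iexp ((\<Sum>i<n. y (W i \<omega>)) / sqrt (real n)) \<partial>P)
          \<longlonglongrightarrow> complex_of_real (exp (- (\<Sum>j<N. (a j)\<^sup>2) / 2))"
      proof (rule char_iid_sum_tendsto[OF _ _ mean _ var])
        show "indep_vars (\<lambda>_. borel) (\<lambda>i \<omega>. y (W i \<omega>)) UNIV"
          by (rule indep_vars_compose2[OF indepW y])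
        show "distr P borel (\<lambda>\<omega>. y (W i \<omega>)) = distr ?U borel y" for i
          using distr_distr[OF y W, of i] unfolding distrW comp_def by (rule sym)
        show "integrable P (\<lambda>\<omega>. (y (W i \<omega>))\<^sup>2)" for i
          using int integrable_distr_eq[OF W y2, of i] unfolding distrW by (rule iffD1[rotated])
      qed
      moreover have "(\<Sum>i<n. y (W i \<omega>)) / sqrt (real n) = (\<Sum>j<N. a j * V n j \<omega>)" for n \<omega>
        unfolding y_def V_def
        by (subst sum.swap) (simp add: sum_divide_distrib sum_distrib_left)
      ultimately show ?thesis by simp
    qed
    have "(\<lambda>n. measure P {\<omega> \<in> space P. t \<le> (\<Sum>j<N. (V n j \<omega>)\<^sup>2)}) \<longlonglongrightarrow> measure (chi_squared N) {t<..}"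
      using P V char False by (rule char_imp_chi_squared_tail)
    then have lim: "limsup (\<lambda>n. ereal (measure P {\<omega> \<in> space P. t \<le> (\<Sum>j<N. (V n j \<omega>)\<^sup>2)})) = ereal (adjusted_p_value m q t)"
      unfolding N by (intro lim_imp_Limsup) auto
    \<comment> \<open>The full sum of squares dominates the statistic, so its nonstrict tail event,
      whose limiting probability is known, contains the event of the claim.\<close>
    have "measure P {\<omega> \<in> space P. test_statistic p m q n (\<theta> n \<omega>) (rk n \<omega>) (Kstar n \<omega>) > t}
        \<le> measure P {\<omega> \<in> space P. t \<le> (\<Sum>j<N. (V n j \<omega>)\<^sup>2)}" for n
    proof (rule finite_measure_mono)
      have "test_statistic p m q n (\<theta> n \<omega>) (rk n \<omega>) (Kstar n \<omega>) \<le> (\<Sum>j<N. (V n j \<omega>)\<^sup>2)" for \<omega>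
        unfolding V_def sum.reindex_bij_betw[OF h,
          of "\<lambda>k. ((\<Sum>i<n. tensor_legendre q k (W i \<omega>)) / sqrt (real n))\<^sup>2"]
        by (rule test)
      then have "t \<le> (\<Sum>j<N. (V n j \<omega>)\<^sup>2)" if "test_statistic p m q n (\<theta> n \<omega>) (rk n \<omega>) (Kstar n \<omega>) > t" for \<omega>
        using that by (rule order.trans[OF less_imp_le, rotated])
      then show "{\<omega> \<in> space P. test_statistic p m q n (\<theta> n \<omega>) (rk n \<omega>) (Kstar n \<omega>) > t}
          \<subseteq> {\<omega> \<in> space P. t \<le> (\<Sum>j<N. (V n j \<omega>)\<^sup>2)}"
        by blast
      have "(\<lambda>\<omega>. \<Sum>j<N. (V n j \<omega>)\<^sup>2) \<in> borel_measurable P"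
        by (intro borel_measurable_sum borel_measurable_power V)
      then show "{\<omega> \<in> space P. t \<le> (\<Sum>j<N. (V n j \<omega>)\<^sup>2)} \<in> events"
        by (intro borel_measurable_le borel_measurable_const)
    qed
    then have "limsup (\<lambda>n. ereal (measure P {\<omega> \<in> space P. test_statistic p m q n (\<theta> n \<omega>) (rk n \<omega>) (Kstar n \<omega>) > t}))
        \<le> limsup (\<lambda>n. ereal (measure P {\<omega> \<in> space P. t \<le> (\<Sum>j<N. (V n j \<omega>)\<^sup>2)}))"
      by (intro Limsup_mono always_eventually allI) simp
    also note lim
    finally show ?thesis .
  qed
qed

end
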